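(* Let $(X,\mathcal{A},\mu,T)$ and $(Y,\mathcal{B},\nu,S)$ be two dynamical systems. If their Poisson suspensions $(X^{*},\mathcal{A}^{*},\mu^{*},T_{*})$ and $(Y^{*},\mathcal{B}^{*},\nu^{*},S_{*})$ are disjoint (their only joining is the product $\mu^*\otimes\nu^*$), then $(X,\mathcal{A},\mu,T)$ and $(Y,\mathcal{B},\nu,S)$ are strongly disjoint.
   Context: The bases are $\sigma$-finite Lebesgue spaces with continuous infinite measures, and $T,S$ are automorphisms (invertible measure preserving transformations). Poisson suspension: $X^{*}$ is the space of measures on $(X,\mathcal{A})$; $\mathcal{A}^{*}$ is generated by the maps $N(A):\xi\mapsto\xi(A)$, $A\in\mathcal{A}$; $\mu^{*}$ is the Poisson measure, under which, for disjoint $A_1,\dots,A_k$ of finite $\mu$-measure, the $N(A_i)$ are independent Poisson variables of parameter $\mu(A_i)$; $T_{*}(\xi)=\xi\circ T^{-1}$. A joining of two systems is an invariant measure (under the product transformation) on the product space whose marginals are the given measures. For $0<c_1,c_2<\infty$, a $(c_1,c_2)$-joining between $(X,\mathcal{A},\mu,T)$ and $(Y,\mathcal{B},\nu,S)$ is a joining between $(X,\mathcal{A},c_1\mu,T)$ and $(Y,\mathcal{B},c_2\nu,S)$. Two systems are strongly disjoint if no $(c_1,c_2)$-joining between them exists, for any $c_1,c_2$. *)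

theory Defs
  imports "HOL-Probability.Probability"
begin

definition iso_mod0 :: "'a measure \<Rightarrow> 'b measure \<Rightarrow> bool" where
  "iso_mod0 M N \<longleftrightarrow> (\<exists>f \<in> measurable M N. \<exists>g \<in> measurable N M.
     distr M N f = N \<and> distr N M g = M \<and>
     (AE x in M. g (f x) = x) \<and> (AE y in N. f (g y) = y))"

(* Rokhlin's definition: isomorphic modulo null sets to an interval I with Lebesgue
   measure together with countably many atoms (w x is the mass at x, and a point of I may
   carry an atom because it is Lebesgue-null). The completions are compared, so that both
   conventions, A complete or A the Borel sets of a standard Borel space, are covered. *)
definition lebesgue_space :: "'a measure \<Rightarrow> bool" where
  "lebesgue_space M \<longleftrightarrow> (\<exists>(L :: real measure) I w.
     sets L = sets borel \<and> is_interval I \<and>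
     countable {x. w x \<noteq> 0} \<and> (\<forall>x. w x < \<infinity>) \<and>
     (\<forall>A \<in> sets borel. emeasure L A =
        emeasure lborel (A \<inter> I) + (\<integral>\<^sup>+x. w x * indicator A x \<partial>count_space UNIV)) \<and>
     iso_mod0 (completion M) (completion L))"

(* Every point is null. The almost-everywhere form does not require {x} to be measurable;
   emeasure M {x} = 0 would also hold when {x} is not in sets M. *)
definition continuous_measure :: "'a measure \<Rightarrow> bool" where
  "continuous_measure M \<longleftrightarrow> (\<forall>x \<in> space M. AE y in M. y \<noteq> x)"

(* Invertibility is understood modulo null sets. *)
definition automorphism :: "'a measure \<Rightarrow> ('a \<Rightarrow> 'a) \<Rightarrow> bool" where
  "automorphism M T \<longleftrightarrow> T \<in> measurable M M \<and> distr M M T = M \<and>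
     (\<exists>R \<in> measurable M M. (AE x in M. R (T x) = x) \<and> (AE x in M. T (R x) = x))"

definition dynamical_system :: "'a measure \<Rightarrow> ('a \<Rightarrow> 'a) \<Rightarrow> bool" where
  "dynamical_system M T \<longleftrightarrow> sigma_finite_measure M \<and> lebesgue_space M \<and>
     continuous_measure M \<and> emeasure M (space M) = \<infinity> \<and> automorphism M T"

(* The measurable space of all measures on M, infinite ones included. Only the sigma-algebra
   of M and of the result matters. *)
definition measures_algebra :: "'a measure \<Rightarrow> 'a measure measure" where
  "measures_algebra M =
     (SUP A \<in> sets M. vimage_algebra {\<xi>. sets \<xi> = sets M} (\<lambda>\<xi>. emeasure \<xi> A) borel)"

(* P is the Poisson measure of M. The point masses are written out because poisson_pmf is
   only specified for a positive rate, and null sets A i are allowed here. *)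
definition poisson_measure :: "'a measure \<Rightarrow> 'a measure measure \<Rightarrow> bool" where
  "poisson_measure M P \<longleftrightarrow> prob_space P \<and> sets P = sets (measures_algebra M) \<and>
     (\<forall>(k::nat) A. (\<forall>i<k. A i \<in> sets M \<and> emeasure M (A i) < \<infinity>) \<and>
         disjoint_family_on A {..<k} \<longrightarrow>
       prob_space.indep_vars P (\<lambda>_. borel) (\<lambda>i \<xi>. emeasure \<xi> (A i)) {..<k} \<and>
       (\<forall>i<k. \<forall>n::nat. measure P {\<xi> \<in> space P. emeasure \<xi> (A i) = of_nat n} =
          exp (- measure M (A i)) * measure M (A i) ^ n / fact n))"

definition suspension_map :: "'a measure \<Rightarrow> ('a \<Rightarrow> 'a) \<Rightarrow> 'a measure \<Rightarrow> 'a measure" where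
  "suspension_map M T \<xi> = distr \<xi> M T"

definition joining ::
  "'a measure \<Rightarrow> ('a \<Rightarrow> 'a) \<Rightarrow> 'b measure \<Rightarrow> ('b \<Rightarrow> 'b) \<Rightarrow> ('a \<times> 'b) measure \<Rightarrow> bool" where
  "joining M T N S J \<longleftrightarrow> sets J = sets (M \<Otimes>\<^sub>M N) \<and>
     distr J J (map_prod T S) = J \<and> distr J M fst = M \<and> distr J N snd = N"

definition disjoint_systems ::
  "'a measure \<Rightarrow> ('a \<Rightarrow> 'a) \<Rightarrow> 'b measure \<Rightarrow> ('b \<Rightarrow> 'b) \<Rightarrow> bool" where
  "disjoint_systems M T N S \<longleftrightarrow> (\<forall>J. joining M T N S J \<longrightarrow> J = M \<Otimes>\<^sub>M N)"

definition scaled_joining :: "real \<Rightarrow> real \<Rightarrow>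
   'a measure \<Rightarrow> ('a \<Rightarrow> 'a) \<Rightarrow> 'b measure \<Rightarrow> ('b \<Rightarrow> 'b) \<Rightarrow> ('a \<times> 'b) measure \<Rightarrow> bool" where
  "scaled_joining c1 c2 M T N S J \<longleftrightarrow>
     joining (scale_measure (ennreal c1) M) T (scale_measure (ennreal c2) N) S J"

definition strongly_disjoint ::
  "'a measure \<Rightarrow> ('a \<Rightarrow> 'a) \<Rightarrow> 'b measure \<Rightarrow> ('b \<Rightarrow> 'b) \<Rightarrow> bool" where
  "strongly_disjoint M T N S \<longleftrightarrow>
     \<not> (\<exists>c1 c2 J. 0 < c1 \<and> 0 < c2 \<and> scaled_joining c1 c2 M T N S J)"

end

theory Submission
  imports Defs
begin

text \<open>
  A joining \<open>J\<close> of the bases, with marginals \<open>c1\<close> times \<open>X\<close> and \<open>c2\<close> times \<open>Y\<close>, produces a joining of the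
  Poisson suspensions that is not the product. Consider a Poisson configuration of points
  \<open>((x, y), t)\<close> with intensity \<open>J \<Otimes>\<^sub>M lborel\<close>; its law is invariant under the suspension of
  \<open>(T \<times> S) \<times> id\<close>. The points with \<open>t \<in> [0, 1 / c1]\<close>, projected to \<open>X\<close>, form a Poisson configuration of
  intensity \<open>X\<close>, because the length of the window cancels \<open>c1\<close>; likewise the points with
  \<open>t \<in> [0, 1 / c2]\<close>, projected to \<open>Y\<close>, form one of intensity \<open>Y\<close>. The joint law of the two projections is a
  joining of \<open>P\<close> and \<open>Q\<close>. The two windows overlap, so points with a small mark are seen on both sides.
  If \<open>J\<close> charges \<open>A \<times> B\<close>, with \<open>A\<close> and \<open>B\<close> of finite measure, then the events that the first projection
  has no point in \<open>A\<close> and that the second has none in \<open>B\<close> are dependent: a void probability is the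
  exponential of minus the intensity of the set, and the intensity of a union is less than the sum
  of the intensities if the intersection has positive intensity.
  The construction is \<open>joining_of_suspensions\<close>, the dependence is
  \<open>poisson_void_events_independent_imp_null_Int\<close>.

  The marginals and the invariance of the new joining are identified through three general facts on
  Poisson measures of \<open>\<sigma>\<close>-finite measures. The mapping theorem \<open>poisson_measure_image\<close> says that
  projections of windows and images under measure-preserving maps are Poisson with the expected
  intensity. By \<open>poisson_measure_unique\<close> the joint laws on disjoint sets of finite measure determine a
  Poisson measure, since finite families of sets split into disjoint atoms. By \<open>ex_poisson_measure\<close> a
  Poisson measure exists: independent Poisson numbers of independent points are placed in countably
  many cells of finite measure. The joint generating function of the counts in disjoint sets factors
  there into generating functions of Poisson laws, and inverting it one variable at a time shows that
  the counts are independent Poisson variables.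
\<close>

section \<open>Poisson laws on the extended half-line and generating functions\<close>

definition poisson_weight :: "real \<Rightarrow> nat \<Rightarrow> real" where
  "poisson_weight m n = exp (- m) * m ^ n / fact n"

text \<open>
  The mass that the Poisson law of parameter \<open>m\<close>, carried by the naturals inside \<open>[0, \<infinity>]\<close>, gives to
  \<open>B\<close>. An explicit series covers \<open>m = 0\<close>, where the law is the unit mass at \<open>0\<close>.\<close>

definition poisson_prob :: "real \<Rightarrow> ennreal set \<Rightarrow> real" where
  "poisson_prob m B = (\<Sum>n. poisson_weight m n * indicator B (of_nat n))"

text \<open>
  For \<open>c n = s ^ n\<close> with \<open>\<bar>s\<bar> < 1\<close> the value \<open>0\<close> at \<open>\<infinity>\<close> is the limit of \<open>s ^ n\<close>, so generating
  functions of counts that may be infinite behave well under increasing limits. Writing the function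
  as a series makes the exchange of expectation and summation immediate.\<close>

definition extend_by_0 :: "(nat \<Rightarrow> real) \<Rightarrow> ennreal \<Rightarrow> real" where
  "extend_by_0 c x = (\<Sum>n. c n * indicator {of_nat n} x)"

lemma sums_single_value: "(\<lambda>n. c n * indicator {of_nat n} (of_nat k :: ennreal)) sums (c k :: real)"
proof -
  have "(\<lambda>n. c n * indicator {of_nat n} (of_nat k :: ennreal)) = (\<lambda>n. if n = k then c n else 0)"
    by (auto simp: fun_eq_iff)
  then show ?thesis
    using sums_single[of k c] by simp
qed

lemma extend_by_0_of_nat [simp]: "extend_by_0 c (of_nat k) = c k"
  unfolding extend_by_0_def using sums_single_value by (rule sums_unique[symmetric])

lemma extend_by_0_other: "x \<notin> range of_nat \<Longrightarrow> extend_by_0 c x = 0"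
proof -
  assume x: "x \<notin> range of_nat"
  have "(\<lambda>n. c n * indicator {of_nat n} x) = (\<lambda>n. 0)"
    using x by (auto simp: fun_eq_iff indicator_def)
  then show ?thesis
    unfolding extend_by_0_def by simp
qed

lemma extend_by_0_top [simp]: "extend_by_0 c \<top> = 0"
  by (rule extend_by_0_other) auto

lemma borel_measurable_extend_by_0 [measurable]: "extend_by_0 c \<in> borel_measurable borel"
  unfolding extend_by_0_def by measurable

lemma abs_extend_by_0_le:
  assumes "\<And>n. \<bar>c n\<bar> \<le> b" "0 \<le> b"
  shows "\<bar>extend_by_0 c x\<bar> \<le> b"
  using assms by (cases "x \<in> range of_nat") (auto simp: extend_by_0_other)

text \<open>
  The first coefficient that is not yet known to vanish is the limit at \<open>0\<close> of the series divided by
  the corresponding power of \<open>s\<close>, and this quotient is identically \<open>0\<close>. Negative \<open>s\<close> are included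
  because the limit is two-sided.\<close>

lemma powser_zero_coeffs:
  fixes d :: "nat \<Rightarrow> real"
  assumes "\<And>s. \<bar>s\<bar> < 1 \<Longrightarrow> (\<lambda>n. d n * s ^ n) sums 0"
  shows "d n = 0"
proof (induction n rule: less_induct)
  case (less n)
  have "(\<lambda>k. d (k + n) * s ^ k) sums 0" if "s \<noteq> 0" "norm s < 1" for s
  proof -
    have "(\<lambda>k. d (k + n) * s ^ (k + n)) sums (0 - (\<Sum>k<n. d k * s ^ k))"
      using assms[of s] that by (subst sums_iff_shift) auto
    then have "(\<lambda>k. d (k + n) * s ^ (k + n)) sums 0"
      using less by simp
    then have "(\<lambda>k. (1 / s ^ n) * (d (k + n) * s ^ (k + n))) sums ((1 / s ^ n) * 0)"
      by (rule sums_mult)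
    then show ?thesis
      using that by (simp add: power_add mult.commute)
  qed
  then have "((\<lambda>_. 0) \<longlongrightarrow> d (0 + n)) (at (0::real))"
    using powser_limit_0_strong[of 1 "\<lambda>k. d (k + n)" "\<lambda>_. 0"] by auto
  then show ?case
    by (simp add: tendsto_const_iff)
qed

text \<open>
  The expectation of a function of \<open>X\<close> is the series of its values against the point masses of \<open>X\<close>. The
  weight \<open>G\<close> stands for a function of further variables, so that joint laws can be treated one
  variable at a time.\<close>

lemma sums_point_masses:
  fixes X :: "'a \<Rightarrow> ennreal"
  assumes G: "integrable M G" and X [measurable]: "X \<in> borel_measurable M"
    and c: "\<And>n. \<bar>c n\<bar> \<le> 1"
  shows "(\<lambda>n. c n * (\<integral>x. G x * indicator {of_nat n} (X x) \<partial>M)) sums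
    (\<integral>x. G x * extend_by_0 c (X x) \<partial>M)"
proof -
  have Gm [measurable]: "G \<in> borel_measurable M"
    using G by auto
  let ?f = "\<lambda>n x. G x * (c n * indicator {of_nat n} (X x))"
  have int: "integrable M (?f n)" for n
    by (rule Bochner_Integration.integrable_bound[OF G])
      (auto simp: abs_mult indicator_def c mult_left_le)
  have sums: "(\<lambda>n. ?f n x) sums (G x * extend_by_0 c (X x))" for x
  proof (cases "X x \<in> range of_nat")
    case True
    then obtain k where k: "X x = of_nat k" by auto
    show ?thesis
      unfolding k extend_by_0_of_nat by (intro sums_mult sums_single_value)
  next
    case False
    then have "(\<lambda>n. ?f n x) = (\<lambda>n. 0)"
      by (auto simp: fun_eq_iff indicator_def)
    with False show ?thesis by (simp add: extend_by_0_other)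
  qed
  have norm_sum: "(\<Sum>n<k. norm (?f n x)) \<le> norm (G x)" for k x
  proof (cases "X x \<in> range of_nat")
    case True
    then obtain j where j: "X x = of_nat j" by auto
    have "(\<Sum>n<k. norm (?f n x)) = (\<Sum>n<k. if n = j then \<bar>G x\<bar> * \<bar>c n\<bar> else 0)"
      unfolding j by (intro sum.cong) (auto simp: abs_mult indicator_def)
    also have "\<dots> \<le> \<bar>G x\<bar>"
      using c[of j] by (auto simp: mult_left_le)
    finally show ?thesis by simp
  next
    case False
    then have "norm (?f n x) = 0" for n
      by (auto simp: indicator_def)
    then have "(\<Sum>n<k. norm (?f n x)) = 0"
      by (intro sum.neutral) blast
    then show ?thesis by simp
  qed
  have "(\<lambda>n. integral\<^sup>L M (?f n)) sums (\<integral>x. (\<Sum>n. ?f n x) \<partial>M)"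
  proof (rule sums_integral[OF int])
    show "AE x in M. summable (\<lambda>n. norm (?f n x))"
      using norm_sum by (intro AE_I2 summableI_nonneg_bounded) auto
    show "summable (\<lambda>n. \<integral>x. norm (?f n x) \<partial>M)"
    proof (rule summableI_nonneg_bounded)
      fix k
      have "(\<Sum>n<k. \<integral>x. norm (?f n x) \<partial>M) = (\<integral>x. (\<Sum>n<k. norm (?f n x)) \<partial>M)"
        using int by (subst Bochner_Integration.integral_sum) auto
      also have "\<dots> \<le> (\<integral>x. norm (G x) \<partial>M)"
        using norm_sum int G by (intro integral_mono) auto
      finally show "(\<Sum>n<k. \<integral>x. norm (?f n x) \<partial>M) \<le> (\<integral>x. norm (G x) \<partial>M)" .
    qed auto
  qed
  moreover have "integral\<^sup>L M (?f n) = c n * (\<integral>x. G x * indicator {of_nat n} (X x) \<partial>M)" for n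
    by (subst integral_mult_right_zero[symmetric]) (simp add: ac_simps)
  moreover have "(\<Sum>n. ?f n x) = G x * extend_by_0 c (X x)" for x
    using sums by (rule sums_unique[symmetric])
  ultimately show ?thesis by simp
qed

lemma poisson_weight_gf: "(\<lambda>n. s ^ n * poisson_weight m n) sums exp ((s - 1) * m)"
proof -
  have "(\<lambda>n. exp (- m) * ((s * m) ^ n /\<^sub>R fact n)) sums (exp (- m) * exp (s * m))"
    by (intro sums_mult exp_converges)
  then show ?thesis
    by (simp add: poisson_weight_def algebra_simps divide_inverse mult_exp_exp)
qed

lemma poisson_weight_sums: "poisson_weight m sums 1"
  using poisson_weight_gf[of 1 m] by simp

lemma poisson_prob_UNIV [simp]: "poisson_prob m UNIV = 1"
  using poisson_weight_sums[of m] by (simp add: poisson_prob_def sums_iff)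

lemma poisson_prob_single [simp]: "poisson_prob m {of_nat n} = poisson_weight m n"
proof -
  have "(\<lambda>k. poisson_weight m k * indicator {of_nat n} (of_nat k :: ennreal)) =
      (\<lambda>k. if k = n then poisson_weight m k else 0)"
    by (auto simp: fun_eq_iff)
  then show ?thesis
    using sums_single[of n "poisson_weight m"] by (simp add: poisson_prob_def sums_iff)
qed

lemma poisson_law_from_weights:
  fixes X :: "'a \<Rightarrow> ennreal"
  assumes G: "integrable M G" and X [measurable]: "X \<in> borel_measurable M"
    and nat: "AE x in M. X x \<in> range of_nat"
    and weight: "\<And>n. (\<integral>x. G x * indicator {of_nat n} (X x) \<partial>M) = C * poisson_weight m n"
    and B [measurable]: "B \<in> sets borel"
  shows "(\<integral>x. G x * indicator B (X x) \<partial>M) = C * poisson_prob m B"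
proof -
  have Gm [measurable]: "G \<in> borel_measurable M"
    using G by auto
  have s: "(\<lambda>n. indicator B (of_nat n) * (C * poisson_weight m n)) sums
      (\<integral>x. G x * extend_by_0 (\<lambda>n. indicator B (of_nat n)) (X x) \<partial>M)"
    using sums_point_masses[OF G X, of "\<lambda>n. indicator B (of_nat n)"] by (simp add: weight)
  have "poisson_prob m B * C = C * (\<Sum>n. poisson_weight m n * indicator B (of_nat n))"
    by (simp add: poisson_prob_def)
  also have "\<dots> = (\<Sum>n. C * (poisson_weight m n * indicator B (of_nat n)))"
  proof (rule suminf_mult[symmetric])
    have abs: "norm (poisson_weight m n * indicator B (of_nat n))
      \<le> poisson_weight \<bar>m\<bar> n * exp (\<bar>m\<bar> - m)" for n
    proof -
      have "poisson_weight \<bar>m\<bar> n * exp (\<bar>m\<bar> - m) = \<bar>poisson_weight m n\<bar>"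
        by (simp add: poisson_weight_def abs_mult power_abs mult_exp_exp)
      then show ?thesis
        by (simp add: abs_mult indicator_def)
    qed
    show "summable (\<lambda>n. poisson_weight m n * indicator B (of_nat n))"
      by (rule summable_comparison_test'[OF summable_mult2[OF sums_summable[OF poisson_weight_sums]] abs])
  qed
  also have "\<dots> = (\<integral>x. G x * extend_by_0 (\<lambda>n. indicator B (of_nat n)) (X x) \<partial>M)"
    using s by (simp add: sums_iff ac_simps)
  also have "\<dots> = (\<integral>x. G x * indicator B (X x) \<partial>M)"
    using nat by (intro integral_cong_AE) auto
  finally show ?thesis by (simp add: mult.commute)
qed

text \<open>
  A generating function on \<open>(-1, 1)\<close> determines its coefficients. With \<open>G = 1\<close> this identifies a law;
  a general \<open>G\<close> gives the contribution of each event \<open>X = n\<close> to the expectation of \<open>G\<close>.\<close>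

lemma poisson_weights_from_gf:
  fixes X :: "'a \<Rightarrow> ennreal"
  assumes G: "integrable M G" and X: "X \<in> borel_measurable M"
    and gf: "\<And>s. \<bar>s\<bar> < 1 \<Longrightarrow>
      (\<integral>x. G x * extend_by_0 (\<lambda>n. s ^ n) (X x) \<partial>M) = C * exp ((s - 1) * m)"
  shows "(\<integral>x. G x * indicator {of_nat n} (X x) \<partial>M) = C * poisson_weight m n"
proof -
  let ?d = "\<lambda>n. (\<integral>x. G x * indicator {of_nat n} (X x) \<partial>M) - C * poisson_weight m n"
  have "(\<lambda>n. ?d n * s ^ n) sums 0" if s: "\<bar>s\<bar> < 1" for s
  proof -
    have "(\<lambda>n. s ^ n * (\<integral>x. G x * indicator {of_nat n} (X x) \<partial>M)) sums (C * exp ((s - 1) * m))"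
      using sums_point_masses[OF G X, of "\<lambda>n. s ^ n"] s
      by (simp add: gf power_abs power_le_one)
    from sums_diff[OF this sums_mult[OF poisson_weight_gf, of C s m]]
    show ?thesis
      by (simp add: algebra_simps)
  qed
  then have "?d n = 0"
    by (rule powser_zero_coeffs)
  then show ?thesis by simp
qed

text \<open>
  The point masses at the naturals add up to \<open>1\<close>, so nothing is left for other values.\<close>

lemma (in prob_space) poisson_law_AE_nat:
  fixes X :: "'a \<Rightarrow> ennreal"
  assumes X [measurable]: "X \<in> borel_measurable M"
    and weight: "\<And>n. prob {x \<in> space M. X x = of_nat n} = poisson_weight m n"
  shows "AE x in M. X x \<in> range of_nat"
proof -
  have int: "expectation (\<lambda>x. (1::real) * indicator {of_nat n} (X x)) = poisson_weight m n" for n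
  proof -
    have "expectation (\<lambda>x. (1::real) * indicator {of_nat n} (X x)) =
        expectation (indicator {x \<in> space M. X x = of_nat n})"
      by (intro Bochner_Integration.integral_cong) (auto simp: indicator_def)
    then show ?thesis
      using weight by simp
  qed
  have "(\<lambda>n. 1 * expectation (\<lambda>x. (1::real) * indicator {of_nat n} (X x))) sums
      expectation (\<lambda>x. 1 * extend_by_0 (\<lambda>_. 1) (X x))"
    by (rule sums_point_masses) auto
  then have "expectation (\<lambda>x. extend_by_0 (\<lambda>_. 1) (X x)) = 1"
    using poisson_weight_sums[of m] int by (simp add: sums_iff)
  moreover have "expectation (\<lambda>x. extend_by_0 (\<lambda>_. 1) (X x)) = 
      expectation (indicator {x \<in> space M. X x \<in> range of_nat})"
    by (intro Bochner_Integration.integral_cong refl) (auto simp: indicator_def extend_by_0_other)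
  moreover have "{x \<in> space M. X x \<in> range of_nat} \<in> sets M"
  proof -
    have "{x \<in> space M. X x \<in> range of_nat} = {x \<in> space M. \<exists>n. X x = of_nat n}"
      by auto
    then show ?thesis by simp
  qed
  ultimately have "prob {x \<in> space M. X x \<in> range of_nat} = 1"
    by simp
  from AE_prob_1[OF this] show ?thesis
    by simp
qed

lemma (in prob_space) poisson_law:
  fixes X :: "'a \<Rightarrow> ennreal"
  assumes X [measurable]: "X \<in> borel_measurable M"
    and weight: "\<And>n. prob {x \<in> space M. X x = of_nat n} = poisson_weight m n"
    and B [measurable]: "B \<in> sets borel"
  shows "prob {x \<in> space M. X x \<in> B} = poisson_prob m B"
proof -
  have ind: "expectation (\<lambda>x. (1::real) * indicator B (X x)) = prob {x \<in> space M. X x \<in> B}"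
    if [measurable]: "B \<in> sets borel" for B
  proof -
    have "expectation (\<lambda>x. (1::real) * indicator B (X x)) = expectation (indicator {x \<in> space M. X x \<in> B})"
      by (intro Bochner_Integration.integral_cong) (auto simp: indicator_def)
    then show ?thesis by simp
  qed
  have "expectation (\<lambda>x. (1::real) * indicator B (X x)) = 1 * poisson_prob m B"
    using poisson_law_AE_nat[OF X weight] ind weight
    by (intro poisson_law_from_weights) auto
  then show ?thesis
    using ind by simp
qed

section \<open>Joint laws and images of Poisson measures\<close>

lemma space_measures_algebra [simp]: "space (measures_algebra M) = {\<xi>. sets \<xi> = sets M}"
  unfolding measures_algebra_def by (auto simp: space_Sup_eq_UN)

lemma measurable_emeasure_measures_algebra:
  assumes "A \<in> sets M"
  shows "(\<lambda>\<xi>. emeasure \<xi> A) \<in> borel_measurable (measures_algebra M)"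
  unfolding measures_algebra_def using assms
  by (intro measurable_SUP1[where i=A] measurable_vimage_algebra1) auto

text \<open>
  Universal property of the \<open>\<sigma>\<close>-algebra generated by the evaluation maps.\<close>

lemma measurable_measures_algebraI:
  assumes "\<And>x. x \<in> space N \<Longrightarrow> sets (f x) = sets M"
    and "\<And>A. A \<in> sets M \<Longrightarrow> (\<lambda>x. emeasure (f x) A) \<in> borel_measurable N"
  shows "f \<in> measurable N (measures_algebra M)"
  unfolding measures_algebra_def using assms
  by (intro measurable_SUP2 measurable_vimage_algebra2) auto

text \<open>
  Together with its converse below, this replaces independence and point masses in the definition of
  a Poisson measure by one formula for the joint law of the counts. In this form the property is
  easy to transport along maps.\<close>

lemma poisson_measureD:
  fixes k :: nat
  assumes P: "poisson_measure M P"
    and A: "\<And>i. i < k \<Longrightarrow> A i \<in> sets M" "\<And>i. i < k \<Longrightarrow> emeasure M (A i) < \<infinity>"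
      "disjoint_family_on A {..<k}"
    and B: "\<And>i. i < k \<Longrightarrow> B i \<in> sets borel"
  shows "measure P {\<xi> \<in> space P. \<forall>i<k. emeasure \<xi> (A i) \<in> B i} =
    (\<Prod>i<k. poisson_prob (measure M (A i)) (B i))"
proof -
  interpret prob_space P
    using P by (simp add: poisson_measure_def)
  have sets: "sets P = sets (measures_algebra M)"
    using P by (simp add: poisson_measure_def)
  have indep: "indep_vars (\<lambda>_. borel) (\<lambda>i \<xi>. emeasure \<xi> (A i)) {..<k}"
    and weight: "\<And>i n. i < k \<Longrightarrow>
      prob {\<xi> \<in> space P. emeasure \<xi> (A i) = of_nat n} = poisson_weight (measure M (A i)) n"
    using P[unfolded poisson_measure_def, THEN conjunct2, THEN conjunct2, rule_format, of k A] A
    by (auto simp: poisson_weight_def)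
  have X: "(\<lambda>\<xi>. emeasure \<xi> (A i)) \<in> borel_measurable P" if "i < k" for i
    using measurable_emeasure_measures_algebra[OF A(1)[OF that]] sets
    by (simp cong: measurable_cong_sets)
  show ?thesis
  proof (cases "k = 0")
    case True
    then show ?thesis by (simp add: prob_space)
  next
    case False
    have "{\<xi> \<in> space P. \<forall>i<k. emeasure \<xi> (A i) \<in> B i} =
        (\<Inter>i\<in>{..<k}. (\<lambda>\<xi>. emeasure \<xi> (A i)) -` B i \<inter> space P)"
      using False by auto
    also have "prob \<dots> = (\<Prod>i<k. prob ((\<lambda>\<xi>. emeasure \<xi> (A i)) -` B i \<inter> space P))"
      using False B by (intro indep_varsD_finite[OF indep]) (auto simp: lessThan_empty_iff)
    also have "\<dots> = (\<Prod>i<k. poisson_prob (measure M (A i)) (B i))"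
    proof (rule prod.cong[OF refl])
      fix i assume "i \<in> {..<k}"
      then have "prob {\<xi> \<in> space P. emeasure \<xi> (A i) \<in> B i} = poisson_prob (measure M (A i)) (B i)"
        using B X weight by (intro poisson_law) auto
      then show "prob ((\<lambda>\<xi>. emeasure \<xi> (A i)) -` B i \<inter> space P) = poisson_prob (measure M (A i)) (B i)"
        by (simp add: vimage_def Int_def conj_commute)
    qed
    finally show ?thesis .
  qed
qed

text \<open>
  The product formula for all families of Borel sets yields independence: the formula for a
  subfamily is the case where the remaining sets are all of \<open>[0, \<infinity>]\<close>, which has Poisson mass \<open>1\<close>.\<close>

lemma poisson_measureI:
  assumes "prob_space P" and sets: "sets P = sets (measures_algebra M)"
    and law: "\<And>(k::nat) A B. (\<And>i. i < k \<Longrightarrow> A i \<in> sets M) \<Longrightarrow>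
      (\<And>i. i < k \<Longrightarrow> emeasure M (A i) < \<infinity>) \<Longrightarrow> disjoint_family_on A {..<k} \<Longrightarrow>
      (\<And>i. i < k \<Longrightarrow> B i \<in> sets borel) \<Longrightarrow>
      measure P {\<xi> \<in> space P. \<forall>i<k. emeasure \<xi> (A i) \<in> B i} =
        (\<Prod>i<k. poisson_prob (measure M (A i)) (B i))"
  shows "poisson_measure M P"
  unfolding poisson_measure_def
proof (intro conjI allI impI)
  interpret prob_space P by fact
  fix k :: nat and A
  assume "(\<forall>i<k. A i \<in> sets M \<and> emeasure M (A i) < \<infinity>) \<and> disjoint_family_on A {..<k}"
  then have A: "\<And>i. i < k \<Longrightarrow> A i \<in> sets M" "\<And>i. i < k \<Longrightarrow> emeasure M (A i) < \<infinity>"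
      "disjoint_family_on A {..<k}"
    by auto
  have X: "(\<lambda>\<xi>. emeasure \<xi> (A i)) \<in> borel_measurable P" if "i < k" for i
    using measurable_emeasure_measures_algebra[OF A(1)[OF that]] sets
    by (simp cong: measurable_cong_sets)
  have joint: "prob {\<xi> \<in> space P. \<forall>j\<in>J. emeasure \<xi> (A j) \<in> B j} =
      (\<Prod>j\<in>J. poisson_prob (measure M (A j)) (B j))"
    if J: "J \<subseteq> {..<k}" and B: "\<And>j. j \<in> J \<Longrightarrow> B j \<in> sets borel" for J B
  proof -
    let ?B = "\<lambda>i. if i \<in> J then B i else UNIV"
    have "prob {\<xi> \<in> space P. \<forall>i<k. emeasure \<xi> (A i) \<in> ?B i} =
        (\<Prod>i<k. poisson_prob (measure M (A i)) (?B i))"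
      using B by (intro law A) auto
    also have "\<dots> = (\<Prod>j\<in>J. poisson_prob (measure M (A j)) (B j))"
      using J by (intro prod.mono_neutral_cong_right) auto
    also have "{\<xi> \<in> space P. \<forall>i<k. emeasure \<xi> (A i) \<in> ?B i} =
        {\<xi> \<in> space P. \<forall>j\<in>J. emeasure \<xi> (A j) \<in> B j}"
      using J by auto
    finally show ?thesis .
  qed
  have marginal: "prob {\<xi> \<in> space P. emeasure \<xi> (A i) \<in> B} = poisson_prob (measure M (A i)) B"
    if "i < k" "B \<in> sets borel" for i B
    using joint[of "{i}" "\<lambda>_. B"] that by simp
  show "indep_vars (\<lambda>_. borel) (\<lambda>i \<xi>. emeasure \<xi> (A i)) {..<k}"
    unfolding indep_vars_def2
  proof (intro conjI ballI indep_setsI)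
    fix i assume "i \<in> {..<k}"
    then show "(\<lambda>\<xi>. emeasure \<xi> (A i)) \<in> borel_measurable P"
      using X by simp
    then show "{(\<lambda>\<xi>. emeasure \<xi> (A i)) -` B \<inter> space P |B. B \<in> sets borel} \<subseteq> events"
      by (auto intro: measurable_sets)
  next
    fix E J
    assume J: "J \<noteq> {}" "J \<subseteq> {..<k}" "finite J"
      and E: "\<forall>j\<in>J. E j \<in> {(\<lambda>\<xi>. emeasure \<xi> (A j)) -` B \<inter> space P |B. B \<in> sets borel}"
    then have "\<forall>j\<in>J. \<exists>B. B \<in> sets borel \<and> E j = {\<xi> \<in> space P. emeasure \<xi> (A j) \<in> B}"
      by (fastforce simp: vimage_def Int_def conj_commute)
    then obtain B where B: "\<And>j. j \<in> J \<Longrightarrow> B j \<in> sets borel"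
        "\<And>j. j \<in> J \<Longrightarrow> E j = {\<xi> \<in> space P. emeasure \<xi> (A j) \<in> B j}"
      by metis
    have "(\<Inter>j\<in>J. E j) = {\<xi> \<in> space P. \<forall>j\<in>J. emeasure \<xi> (A j) \<in> B j}"
      using J(1) B(2) by auto
    then have "prob (\<Inter>j\<in>J. E j) = (\<Prod>j\<in>J. poisson_prob (measure M (A j)) (B j))"
      using joint[OF J(2) B(1)] by simp
    also have "\<dots> = (\<Prod>j\<in>J. prob (E j))"
      using B J(2) by (intro prod.cong) (auto simp: marginal)
    finally show "prob (\<Inter>j\<in>J. E j) = (\<Prod>j\<in>J. prob (E j))" .
  qed
  fix i and n :: nat assume "i < k"
  then have "prob {\<xi> \<in> space P. emeasure \<xi> (A i) \<in> {of_nat n}} = poisson_prob (measure M (A i)) {of_nat n}"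
    by (intro marginal) auto
  then show "prob {\<xi> \<in> space P. emeasure \<xi> (A i) = of_nat n} =
      exp (- measure M (A i)) * measure M (A i) ^ n / fact n"
    by (simp add: poisson_weight_def)
qed fact+

text \<open>
  Mapping theorem. If the image configuration \<open>\<Phi> \<zeta>\<close> counts in \<open>A\<close> what \<open>\<zeta>\<close> counts in \<open>F A\<close>, where
  \<open>F\<close> preserves measure and disjointness, then counts of the image over disjoint sets are counts of
  the original over disjoint sets of the same measure. Keeping \<open>F\<close> abstract covers transport by a
  measure-preserving map as well as projection of a part of the space.\<close>

lemma
  assumes P: "poisson_measure M P"
    and \<Phi>_sets: "\<And>\<zeta>. sets \<zeta> = sets M \<Longrightarrow> sets (\<Phi> \<zeta>) = sets N"
    and \<Phi>: "\<And>\<zeta> A. sets \<zeta> = sets M \<Longrightarrow> A \<in> sets N \<Longrightarrow> emeasure (\<Phi> \<zeta>) A = emeasure \<zeta> (F A)"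
    and F: "\<And>A. A \<in> sets N \<Longrightarrow> F A \<in> sets M"
      "\<And>A. A \<in> sets N \<Longrightarrow> emeasure M (F A) = emeasure N A"
      "\<And>A B. A \<inter> B = {} \<Longrightarrow> F A \<inter> F B = {}"
  shows poisson_measure_image_measurable: "\<Phi> \<in> measurable P (measures_algebra N)"
    and poisson_measure_image: "poisson_measure N (distr P (measures_algebra N) \<Phi>)"
proof -
  interpret prob_space P
    using P by (simp add: poisson_measure_def)
  have sets [measurable_cong]: "sets P = sets (measures_algebra M)"
    using P by (simp add: poisson_measure_def)
  have space: "space P = {\<xi>. sets \<xi> = sets M}"
    using sets_eq_imp_space_eq[OF sets] by simp
  show meas [measurable]: "\<Phi> \<in> measurable P (measures_algebra N)"
  proof (rule measurable_measures_algebraI)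
    fix A assume A: "A \<in> sets N"
    have "(\<lambda>\<zeta>. emeasure \<zeta> (F A)) \<in> borel_measurable P"
      using measurable_emeasure_measures_algebra[OF F(1)[OF A]] by measurable
    then show "(\<lambda>\<zeta>. emeasure (\<Phi> \<zeta>) A) \<in> borel_measurable P"
      using A by (subst measurable_cong[where g="\<lambda>\<zeta>. emeasure \<zeta> (F A)"]) (auto simp: space \<Phi>)
  qed (auto simp: space \<Phi>_sets)
  show "poisson_measure N (distr P (measures_algebra N) \<Phi>)"
  proof (rule poisson_measureI)
    show "prob_space (distr P (measures_algebra N) \<Phi>)"
      by (rule prob_space_distr) measurable
    fix k :: nat and A and B :: "nat \<Rightarrow> ennreal set"
    assume A: "\<And>i. i < k \<Longrightarrow> A i \<in> sets N" "\<And>i. i < k \<Longrightarrow> emeasure N (A i) < \<infinity>"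
        "disjoint_family_on A {..<k}"
      and B [measurable]: "\<And>i. i < k \<Longrightarrow> B i \<in> sets borel"
    have [measurable]: "(\<lambda>\<xi>. emeasure \<xi> (A i)) \<in> borel_measurable (measures_algebra N)" if "i < k" for i
      using that A by (intro measurable_emeasure_measures_algebra)
    have "{\<xi> \<in> space (measures_algebra N). \<forall>i\<in>{..<k}. emeasure \<xi> (A i) \<in> B i} \<in> sets (measures_algebra N)"
      by measurable
    then have "{\<xi> \<in> space (measures_algebra N). \<forall>i<k. emeasure \<xi> (A i) \<in> B i} \<in> sets (measures_algebra N)"
      by (simp only: Ball_def lessThan_iff)
    then have "measure (distr P (measures_algebra N) \<Phi>)
        {\<xi> \<in> space (distr P (measures_algebra N) \<Phi>). \<forall>i<k. emeasure \<xi> (A i) \<in> B i} =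
        prob (\<Phi> -` {\<xi> \<in> space (measures_algebra N). \<forall>i<k. emeasure \<xi> (A i) \<in> B i} \<inter> space P)"
      by (subst measure_distr) auto
    also have "\<Phi> -` {\<xi> \<in> space (measures_algebra N). \<forall>i<k. emeasure \<xi> (A i) \<in> B i} \<inter> space P =
        {\<zeta> \<in> space P. \<forall>i<k. emeasure \<zeta> (F (A i)) \<in> B i}"
      using A(1) by (auto simp: space \<Phi> \<Phi>_sets)
    also have "prob \<dots> = (\<Prod>i<k. poisson_prob (measure M (F (A i))) (B i))"
      using A B F by (intro poisson_measureD[OF P]) (auto simp: disjoint_family_on_def)
    also have "\<dots> = (\<Prod>i<k. poisson_prob (measure N (A i)) (B i))"
      using A(1) F(2) by (simp add: measure_def)
    finally show "measure (distr P (measures_algebra N) \<Phi>)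
        {\<xi> \<in> space (distr P (measures_algebra N) \<Phi>). \<forall>i<k. emeasure \<xi> (A i) \<in> B i} =
        (\<Prod>i<k. poisson_prob (measure N (A i)) (B i))" .
  qed simp
qed

section \<open>Uniqueness of the Poisson measure\<close>

text \<open>
  The constraints are indexed by the sets themselves; then the intersection of two cylinders is
  again a cylinder, over the union of the index sets.\<close>

definition cylinder :: "'a measure \<Rightarrow> 'a set set \<Rightarrow> ('a set \<Rightarrow> ennreal set) \<Rightarrow> 'a measure set" where
  "cylinder M F B = {\<xi>. sets \<xi> = sets M \<and> (\<forall>A\<in>F. emeasure \<xi> A \<in> B A)}"

definition cylinders :: "'a measure \<Rightarrow> 'a measure set set" where
  "cylinders M = {cylinder M F B | F B.
     finite F \<and> F \<subseteq> {A \<in> sets M. emeasure M A < \<infinity>} \<and> (\<forall>A. B A \<in> sets borel)}"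

lemma cylindersI:
  assumes "finite F" "F \<subseteq> {A \<in> sets M. emeasure M A < \<infinity>}" "\<And>A. B A \<in> sets borel"
  shows "cylinder M F B \<in> cylinders M"
  using assms unfolding cylinders_def by blast

lemma Int_stable_cylinders: "Int_stable (cylinders M)"
proof (rule Int_stableI)
  fix a b assume "a \<in> cylinders M" "b \<in> cylinders M"
  then obtain F B F' B' where F: "finite F" "F \<subseteq> {A \<in> sets M. emeasure M A < \<infinity>}" "\<forall>A. B A \<in> sets borel"
      "a = cylinder M F B"
    and F': "finite F'" "F' \<subseteq> {A \<in> sets M. emeasure M A < \<infinity>}" "\<forall>A. B' A \<in> sets borel"
      "b = cylinder M F' B'"
    unfolding cylinders_def by blast
  let ?B = "\<lambda>A. (if A \<in> F then B A else UNIV) \<inter> (if A \<in> F' then B' A else UNIV)"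
  have "a \<inter> b = cylinder M (F \<union> F') ?B"
    unfolding F(4) F'(4) cylinder_def by auto
  moreover have "cylinder M (F \<union> F') ?B \<in> cylinders M"
    using F F' by (intro cylindersI) auto
  ultimately show "a \<inter> b \<in> cylinders M"
    by simp
qed

text \<open>
  Only counts on sets of finite measure enter the cylinders. They suffice because, by
  \<open>\<sigma>\<close>-finiteness and continuity from below of each \<open>\<xi>\<close>, every count is a countable supremum of such
  counts.\<close>

lemma (in sigma_finite_measure) sets_measures_algebra:
  "sets (measures_algebra M) = sigma_sets {\<xi>. sets \<xi> = sets M} (cylinders M)"
proof
  let ?\<Omega> = "{\<xi> :: 'a measure. sets \<xi> = sets M}"
  have sub: "cylinders M \<subseteq> Pow ?\<Omega>"
    by (auto simp: cylinders_def cylinder_def)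
  have "cylinders M \<subseteq> sets (measures_algebra M)"
  proof
    fix a assume "a \<in> cylinders M"
    then obtain F B where F: "finite F" "F \<subseteq> {A \<in> sets M. emeasure M A < \<infinity>}"
        and [measurable]: "\<And>A. B A \<in> sets borel" and a: "a = cylinder M F B"
      unfolding cylinders_def by blast
    have [measurable]: "(\<lambda>\<xi>. emeasure \<xi> A) \<in> borel_measurable (measures_algebra M)" if "A \<in> F" for A
      using that F by (intro measurable_emeasure_measures_algebra) auto
    have "{\<xi> \<in> space (measures_algebra M). \<forall>A\<in>F. emeasure \<xi> A \<in> B A} \<in> sets (measures_algebra M)"
      using F(1) by measurable
    then show "a \<in> sets (measures_algebra M)"
      by (simp add: a cylinder_def)
  qed
  then show "sigma_sets ?\<Omega> (cylinders M) \<subseteq> sets (measures_algebra M)"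
    using sets.sigma_sets_subset[of "cylinders M" "measures_algebra M"] by simp
  let ?N = "sigma ?\<Omega> (cylinders M)"
  obtain D :: "nat \<Rightarrow> 'a set" where D: "range D \<subseteq> sets M" "(\<Union>i. D i) = space M"
      "\<And>i. emeasure M (D i) \<noteq> \<infinity>" "incseq D"
    using sigma_finite_incseq by metis
  have spN: "space ?N = ?\<Omega>"
    using sub by (simp add: space_measure_of)
  have fin: "(\<lambda>\<xi>. emeasure \<xi> A) \<in> borel_measurable ?N" if A: "A \<in> sets M" "emeasure M A < \<infinity>" for A
  proof (rule measurableI)
    fix B :: "ennreal set" assume "B \<in> sets borel"
    then have "cylinder M {A} (\<lambda>_. B) \<in> cylinders M"
      using A by (intro cylindersI) auto
    moreover have "(\<lambda>\<xi>. emeasure \<xi> A) -` B \<inter> space ?N = cylinder M {A} (\<lambda>_. B)"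
      unfolding spN by (auto simp: cylinder_def)
    ultimately show "(\<lambda>\<xi>. emeasure \<xi> A) -` B \<inter> space ?N \<in> sets ?N"
      using sub by (simp add: sets_measure_of)
  qed auto
  have "(\<lambda>\<xi>. \<xi>) \<in> measurable ?N (measures_algebra M)"
  proof (rule measurable_measures_algebraI)
    fix A assume A: "A \<in> sets M"
    have "emeasure \<xi> A = (SUP n. emeasure \<xi> (A \<inter> D n))" if "\<xi> \<in> space ?N" for \<xi>
    proof -
      have sets: "sets \<xi> = sets M"
        using that spN by auto
      have "(SUP n. emeasure \<xi> (A \<inter> D n)) = emeasure \<xi> (\<Union>n. A \<inter> D n)"
        using A D by (intro SUP_emeasure_incseq) (auto 4 3 simp: sets incseq_def)
      also have "(\<Union>n. A \<inter> D n) = A"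
        using D(2) sets.sets_into_space[OF A] by auto
      finally show ?thesis ..
    qed
    moreover have "(\<lambda>\<xi>. SUP n. emeasure \<xi> (A \<inter> D n)) \<in> borel_measurable ?N"
    proof (intro borel_measurable_SUP fin)
      fix n
      show "A \<inter> D n \<in> sets M"
        using A D by auto
      have "emeasure M (A \<inter> D n) \<le> emeasure M (D n)"
        using A D by (intro emeasure_mono) auto
      then show "emeasure M (A \<inter> D n) < \<infinity>"
        using D(3)[of n] by (auto simp: less_top[symmetric] top_unique)
    qed auto
    ultimately show "(\<lambda>\<xi>. emeasure \<xi> A) \<in> borel_measurable ?N"
      by (subst measurable_cong) auto
  qed (use spN in auto)
  then have "sets (measures_algebra M) \<subseteq> sets ?N"
  proof (intro subsetI)
    fix a assume m: "(\<lambda>\<xi>. \<xi>) \<in> measurable ?N (measures_algebra M)" and a: "a \<in> sets (measures_algebra M)"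
    then have "(\<lambda>\<xi>. \<xi>) -` a \<inter> space ?N \<in> sets ?N"
      by (rule measurable_sets)
    moreover have "(\<lambda>\<xi>. \<xi>) -` a \<inter> space ?N = a"
      using sets.sets_into_space[OF a] spN by auto
    ultimately show "a \<in> sets ?N" by simp
  qed
  then show "sets (measures_algebra M) \<subseteq> sigma_sets ?\<Omega> (cylinders M)"
    using sub by (simp add: sets_measure_of)
qed

text \<open>
  The definition of a Poisson measure speaks about disjoint sets only. An arbitrary finite family is
  reduced to this case by passing to atoms of the algebra it generates: an atom
  consists of the points lying in all members of a nonempty subfamily \<open>H\<close> and in no other member.\<close>

lemma ex_disjoint_atoms:
  assumes F: "finite F" "F \<subseteq> sets M"
  obtains k :: nat and a :: "nat \<Rightarrow> 'a set" and I :: "'a set \<Rightarrow> nat set"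
  where "\<And>i. i < k \<Longrightarrow> a i \<in> sets M" "disjoint_family_on a {..<k}"
    "\<And>i. i < k \<Longrightarrow> \<exists>A\<in>F. a i \<subseteq> A"
    "\<And>A. A \<in> F \<Longrightarrow> I A \<subseteq> {..<k}" "\<And>A. A \<in> F \<Longrightarrow> A = (\<Union>i\<in>I A. a i)"
proof -
  define atom where "atom H = \<Inter>H - \<Union>(F - H)" for H
  have "finite (Pow F - {{}})"
    using F by simp
  then obtain e where e: "bij_betw e {0..<card (Pow F - {{}})} (Pow F - {{}})"
    using ex_bij_betw_nat_finite by blast
  define k where "k = card (Pow F - {{}})"
  have e_in: "e i \<subseteq> F" "e i \<noteq> {}" if "i < k" for i
    using bij_betwE[OF e] that by (auto simp: k_def)
  show ?thesis
  proof (rule that[of k "\<lambda>i. atom (e i)" "\<lambda>A. {i. i < k \<and> A \<in> e i}"])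
    fix i assume i: "i < k"
    have "finite (e i)"
      using e_in[OF i] F finite_subset by blast
    then have "\<Inter>(e i) \<in> sets M"
      using sets.finite_INT[of "e i" "\<lambda>x. x" M] e_in[OF i] F by auto
    moreover have "\<Union>(F - e i) \<in> sets M"
      using F by (intro sets.finite_Union) auto
    ultimately show "atom (e i) \<in> sets M"
      unfolding atom_def by (rule sets.Diff)
    show "\<exists>A\<in>F. atom (e i) \<subseteq> A"
      using e_in[OF i] by (auto simp: atom_def)
  next
    have "atom (e i) \<inter> atom (e j) = {}" if ij: "i < k" "j < k" "i \<noteq> j" for i j
    proof -
      have "e i \<noteq> e j"
        using e ij by (auto simp: bij_betw_def inj_on_def k_def)
      then show ?thesis
        using e_in[OF ij(1)] e_in[OF ij(2)] unfolding atom_def by blast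
    qed
    then show "disjoint_family_on (\<lambda>i. atom (e i)) {..<k}"
      by (auto simp: disjoint_family_on_def)
  next
    fix A assume A: "A \<in> F"
    show "A = (\<Union>i\<in>{i. i < k \<and> A \<in> e i}. atom (e i))"
    proof (intro equalityI subsetI)
      fix x assume x: "x \<in> A"
      let ?H = "{A \<in> F. x \<in> A}"
      have "?H \<in> Pow F - {{}}"
        using A x by auto
      then have "?H \<in> e ` {0..<k}"
        using e unfolding bij_betw_def k_def by simp
      then obtain i where "i < k" "e i = ?H"
        by force
      then show "x \<in> (\<Union>i\<in>{i. i < k \<and> A \<in> e i}. atom (e i))"
        using A x by (auto simp: atom_def)
    qed (auto simp: atom_def)
  qed auto
qed

text \<open>
  Two Poisson measures of \<open>M\<close> agree on cylinders: the counts on the sets of a cylinder are sums of the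
  counts on atoms, and the joint law of the latter is given by the product formula. Cylinders are
  stable under intersection and generate the \<open>\<sigma>\<close>-algebra.\<close>

theorem (in sigma_finite_measure) poisson_measure_unique:
  assumes P: "poisson_measure M P" and Q: "poisson_measure M Q"
  shows "P = Q"
proof (rule measure_eqI_generator_eq[OF Int_stable_cylinders])
  let ?\<Omega> = "{\<xi> :: 'a measure. sets \<xi> = sets M}"
  interpret P: prob_space P using P by (simp add: poisson_measure_def)
  interpret Q: prob_space Q using Q by (simp add: poisson_measure_def)
  have sets_P [measurable_cong]: "sets P = sets (measures_algebra M)"
    and sets_Q [measurable_cong]: "sets Q = sets (measures_algebra M)"
    using P Q by (auto simp: poisson_measure_def)
  have space: "space P = ?\<Omega>" "space Q = ?\<Omega>"
    using sets_eq_imp_space_eq[OF sets_P] sets_eq_imp_space_eq[OF sets_Q] by simp_all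
  show "cylinders M \<subseteq> Pow ?\<Omega>"
    by (auto simp: cylinders_def cylinder_def)
  show "sets P = sigma_sets ?\<Omega> (cylinders M)" "sets Q = sigma_sets ?\<Omega> (cylinders M)"
    using sets_P sets_Q sets_measures_algebra by auto
  have "?\<Omega> = cylinder M {} (\<lambda>_. UNIV)"
    by (auto simp: cylinder_def)
  also have "\<dots> \<in> cylinders M"
    by (rule cylindersI) auto
  finally show "range (\<lambda>_::nat. ?\<Omega>) \<subseteq> cylinders M"
    by auto
  show "(\<Union>i::nat. ?\<Omega>) = ?\<Omega>" by simp
  show "emeasure P ?\<Omega> \<noteq> \<infinity>" by simp
  fix c assume "c \<in> cylinders M"
  then obtain F B where F: "finite F" "F \<subseteq> {A \<in> sets M. emeasure M A < \<infinity>}"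
      and B [measurable]: "\<And>A. B A \<in> sets borel" and c: "c = cylinder M F B"
    unfolding cylinders_def by blast
  obtain k :: nat and a I where a: "\<And>i. i < k \<Longrightarrow> a i \<in> sets M" "disjoint_family_on a {..<k}"
    "\<And>i. i < k \<Longrightarrow> \<exists>A\<in>F. a i \<subseteq> A"
    and I: "\<And>A. A \<in> F \<Longrightarrow> I A \<subseteq> {..<k}" "\<And>A. A \<in> F \<Longrightarrow> A = (\<Union>i\<in>I A. a i)"
  proof (rule ex_disjoint_atoms)
    show "finite F" "F \<subseteq> sets M"
      using F by auto
  qed (rule that)
  have fin: "emeasure M (a i) < \<infinity>" if i: "i < k" for i
  proof -
    obtain A where A: "A \<in> F" "a i \<subseteq> A"
      using a(3)[OF i] by blast
    then have "emeasure M (a i) \<le> emeasure M A"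
      using F(2) by (intro emeasure_mono) auto
    then show ?thesis
      using A F(2) by (auto intro: le_less_trans)
  qed
  let ?V = "\<lambda>\<xi>. \<lambda>i\<in>{..<k}. emeasure \<xi> (a i)" and ?R = "PiM {..<k} (\<lambda>_. borel :: ennreal measure)"
  have [measurable]: "(\<lambda>\<xi>. emeasure \<xi> (a i)) \<in> borel_measurable (measures_algebra M)" if "i < k" for i
    using a(1)[OF that] by (rule measurable_emeasure_measures_algebra)
  have V [measurable]: "?V \<in> measurable (measures_algebra M) ?R"
    by (rule measurable_restrict) auto
  have eq: "distr P ?R ?V = distr Q ?R ?V"
  proof (rule measure_eqI_PiM_finite)
    fix C :: "nat \<Rightarrow> ennreal set" assume C: "\<And>i. i \<in> {..<k} \<Longrightarrow> C i \<in> sets borel"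
    then have CM: "Pi\<^sub>E {..<k} C \<in> sets ?R"
      by (intro sets_PiM_I_finite) auto
    have vim: "?V -` Pi\<^sub>E {..<k} C \<inter> space P' = {\<xi> \<in> space P'. \<forall>i<k. emeasure \<xi> (a i) \<in> C i}" for P'
      unfolding set_eq_iff by (simp add: Pi_iff Ball_def conj_commute)
    have "P.prob {\<xi> \<in> space P. \<forall>i<k. emeasure \<xi> (a i) \<in> C i} =
        Q.prob {\<xi> \<in> space Q. \<forall>i<k. emeasure \<xi> (a i) \<in> C i}"
    proof (rule trans)
      have C': "\<And>i. i < k \<Longrightarrow> C i \<in> sets borel"
        using C by simp
      show "P.prob {\<xi> \<in> space P. \<forall>i<k. emeasure \<xi> (a i) \<in> C i} =
          (\<Prod>i<k. poisson_prob (measure M (a i)) (C i))"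
        by (rule poisson_measureD[OF P]) (fact a fin C')+
      show "(\<Prod>i<k. poisson_prob (measure M (a i)) (C i)) =
          Q.prob {\<xi> \<in> space Q. \<forall>i<k. emeasure \<xi> (a i) \<in> C i}"
        by (rule poisson_measureD[OF Q, symmetric]) (fact a fin C')+
    qed
    then show "emeasure (distr P ?R ?V) (Pi\<^sub>E {..<k} C) = emeasure (distr Q ?R ?V) (Pi\<^sub>E {..<k} C)"
      using CM by (simp add: emeasure_distr vim P.emeasure_eq_measure Q.emeasure_eq_measure)
  next
    show "range (\<lambda>_::nat. space ?R) \<subseteq> prod_algebra {..<k} (\<lambda>_. borel :: ennreal measure)"
      unfolding space_PiM by (auto intro!: prod_algebraI_finite)
    interpret D: prob_space "distr P ?R ?V"
      by (rule P.prob_space_distr) measurable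
    show "emeasure (distr P ?R ?V) (space ?R) \<noteq> \<infinity>"
      by simp
  qed auto
  have c_eq: "c = ?V -` {v \<in> space ?R. \<forall>A\<in>F. (\<Sum>i\<in>I A. v i) \<in> B A} \<inter> ?\<Omega>"
  proof -
    have "emeasure \<xi> A = (\<Sum>i\<in>I A. ?V \<xi> i)" if \<xi>: "sets \<xi> = sets M" and A: "A \<in> F" for \<xi> A
    proof -
      have "(\<Sum>i\<in>I A. emeasure \<xi> (a i)) = emeasure \<xi> (\<Union>i\<in>I A. a i)"
        using a(1,2) I(1)[OF A] \<xi>
        by (intro sum_emeasure) (auto simp: disjoint_family_on_def intro: finite_subset)
      moreover have "(\<Sum>i\<in>I A. ?V \<xi> i) = (\<Sum>i\<in>I A. emeasure \<xi> (a i))"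
        using I(1)[OF A] by (intro sum.cong) auto
      ultimately show ?thesis
        using I(2)[OF A] by simp
    qed
    then show ?thesis
      unfolding c cylinder_def by (auto simp: space_PiM)
  qed
  have [measurable]: "(\<lambda>v. \<Sum>i\<in>I A. v i) \<in> borel_measurable ?R" if "A \<in> F" for A
    using I(1)[OF that] by (intro borel_measurable_sum measurable_component_singleton) auto
  have S: "{v \<in> space ?R. \<forall>A\<in>F. (\<Sum>i\<in>I A. v i) \<in> B A} \<in> sets ?R"
    using F(1) by measurable
  have "emeasure P c = emeasure (distr P ?R ?V) {v \<in> space ?R. \<forall>A\<in>F. (\<Sum>i\<in>I A. v i) \<in> B A}"
    using S unfolding c_eq by (subst emeasure_distr) (auto simp: space)
  also have "\<dots> = emeasure Q c"
    using S unfolding c_eq eq by (subst emeasure_distr) (auto simp: space)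
  finally show "emeasure P c = emeasure Q c" .
qed

section \<open>Inversion of joint generating functions\<close>

lemma abs_prod_le_1:
  fixes f :: "'i \<Rightarrow> real"
  assumes "\<And>i. i \<in> I \<Longrightarrow> \<bar>f i\<bar> \<le> 1"
  shows "\<bar>\<Prod>i\<in>I. f i\<bar> \<le> 1"
  using assms by (simp add: abs_prod prod_le_1)

text \<open>
  Inversion of joint generating functions. The variables are inverted one after the other: the
  intermediate quantity \<open>mixed\<close> has indicators for the variables in \<open>J\<close> and powers for the others, and
  one more variable moves to \<open>J\<close> by uniqueness of power series coefficients, with all other factors
  as weight \<open>G\<close>. Assuming the formula for subfamilies \<open>J\<close> gives the one-dimensional laws, hence
  almost surely finite counts.\<close>

lemma (in prob_space) poisson_joint_law_from_gf:
  fixes X :: "'i \<Rightarrow> 'a \<Rightarrow> ennreal"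
  assumes I: "finite I" and X [measurable]: "\<And>i. i \<in> I \<Longrightarrow> X i \<in> borel_measurable M"
    and gf: "\<And>J s. J \<subseteq> I \<Longrightarrow> (\<And>i. \<bar>s i\<bar> < 1) \<Longrightarrow>
      expectation (\<lambda>x. \<Prod>i\<in>J. extend_by_0 (\<lambda>n. s i ^ n) (X i x)) = (\<Prod>i\<in>J. exp ((s i - 1) * m i))"
    and B [measurable]: "\<And>i. i \<in> I \<Longrightarrow> B i \<in> sets borel"
  shows "prob {x \<in> space M. \<forall>i\<in>I. X i x \<in> B i} = (\<Prod>i\<in>I. poisson_prob (m i) (B i))"
proof -
  have nat: "AE x in M. X i x \<in> range of_nat" if i: "i \<in> I" for i
  proof (rule poisson_law_AE_nat[OF X[OF i]])
    fix n
    have "expectation (\<lambda>x. (1::real) * indicator {of_nat n} (X i x)) = 1 * poisson_weight (m i) n"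
    proof (rule poisson_weights_from_gf[OF _ X[OF i]])
      fix s :: real assume "\<bar>s\<bar> < 1"
      then show "expectation (\<lambda>x. 1 * extend_by_0 (\<lambda>n. s ^ n) (X i x)) = 1 * exp ((s - 1) * m i)"
        using gf[of "{i}" "\<lambda>_. s"] i by simp
    qed simp
    also have "expectation (\<lambda>x. (1::real) * indicator {of_nat n} (X i x)) =
        expectation (indicator {x \<in> space M. X i x = of_nat n})"
      by (intro Bochner_Integration.integral_cong) (auto simp: indicator_def)
    finally show "prob {x \<in> space M. X i x = of_nat n} = poisson_weight (m i) n"
      using X[OF i] by simp
  qed
  \<comment> \<open>Induction on the set of variables that are already inverted.\<close>
  have mixed: "expectation (\<lambda>x. (\<Prod>j\<in>J. indicator (B j) (X j x)) *
        (\<Prod>i\<in>I - J. extend_by_0 (\<lambda>n. s i ^ n) (X i x))) =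
      (\<Prod>j\<in>J. poisson_prob (m j) (B j)) * (\<Prod>i\<in>I - J. exp ((s i - 1) * m i))"
    if "finite J" "J \<subseteq> I" "\<And>i. \<bar>s i\<bar> < 1" for J s
    using that
  proof (induction J arbitrary: s rule: finite_induct)
    case empty
    then show ?case using gf[of I s] by simp
  next
    case (insert a J)
    have a: "a \<in> I" "a \<notin> J" and J: "J \<subseteq> I" and s: "\<And>i. \<bar>s i\<bar> < 1"
      using insert by auto
    have fin: "finite J" "finite (I - insert a J)"
      using insert I by auto
    have split: "I - J = insert a (I - insert a J)"
      using a by auto
    let ?G = "\<lambda>x. (\<Prod>j\<in>J. indicator (B j) (X j x)) *
        (\<Prod>i\<in>I - insert a J. extend_by_0 (\<lambda>n. s i ^ n) (X i x)) :: real"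
    let ?C = "(\<Prod>j\<in>J. poisson_prob (m j) (B j)) * (\<Prod>i\<in>I - insert a J. exp ((s i - 1) * m i))"
    have "(\<lambda>x. \<Prod>j\<in>J. indicator (B j) (X j x) :: real) \<in> borel_measurable M"
      using J by (intro borel_measurable_prod borel_measurable_indicator' measurable_compose[OF X]) auto
    moreover have "(\<lambda>x. \<Prod>i\<in>I - insert a J. extend_by_0 (\<lambda>n. s i ^ n) (X i x)) \<in> borel_measurable M"
      by (intro borel_measurable_prod measurable_compose[OF X borel_measurable_extend_by_0]) auto
    ultimately have Gm: "?G \<in> borel_measurable M"
      by (rule borel_measurable_times)
    have "\<bar>?G x\<bar> \<le> 1" for x
    proof -
      have "\<bar>\<Prod>j\<in>J. indicator (B j) (X j x) :: real\<bar> \<le> 1"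
        by (rule abs_prod_le_1) (auto simp: indicator_def)
      moreover have "\<bar>\<Prod>i\<in>I - insert a J. extend_by_0 (\<lambda>n. s i ^ n) (X i x)\<bar> \<le> 1"
        using s by (intro abs_prod_le_1 abs_extend_by_0_le) (auto simp: power_abs less_imp_le power_le_one)
      ultimately show ?thesis
        by (simp add: abs_mult mult_le_one)
    qed
    then have G: "integrable M ?G"
      using Gm by (intro integrable_const_bound[where B=1]) auto
    have "expectation (\<lambda>x. ?G x * indicator (B a) (X a x)) = ?C * poisson_prob (m a) (B a)"
    proof (rule poisson_law_from_weights[OF G X[OF a(1)] nat[OF a(1)] _ B[OF a(1)]])
      fix n
      show "expectation (\<lambda>x. ?G x * indicator {of_nat n} (X a x)) = ?C * poisson_weight (m a) n"
      proof (rule poisson_weights_from_gf[OF G X[OF a(1)]])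
        fix t :: real assume t: "\<bar>t\<bar> < 1"
        \<comment> \<open>The variable \<open>a\<close> gets the free parameter \<open>t\<close>; the others keep theirs.\<close>
        have rest: "(\<Prod>i\<in>I - insert a J. extend_by_0 (\<lambda>n. (s(a := t)) i ^ n) (X i x)) =
            (\<Prod>i\<in>I - insert a J. extend_by_0 (\<lambda>n. s i ^ n) (X i x))"
          "(\<Prod>i\<in>I - insert a J. exp (((s(a := t)) i - 1) * m i)) = (\<Prod>i\<in>I - insert a J. exp ((s i - 1) * m i))" for x
          by (auto intro!: prod.cong)
        have "expectation (\<lambda>x. (\<Prod>j\<in>J. indicator (B j) (X j x)) *
            (\<Prod>i\<in>I - J. extend_by_0 (\<lambda>n. (s(a := t)) i ^ n) (X i x))) =
          (\<Prod>j\<in>J. poisson_prob (m j) (B j)) * (\<Prod>i\<in>I - J. exp (((s(a := t)) i - 1) * m i))"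
          using s t J by (intro insert.IH) auto
        then show "expectation (\<lambda>x. ?G x * extend_by_0 (\<lambda>n. t ^ n) (X a x)) = ?C * exp ((t - 1) * m a)"
          unfolding split prod.insert[OF fin(2), of a, simplified] rest by (simp add: ac_simps)
      qed
    qed
    then show ?case
      using a(2) fin(1) by (simp add: ac_simps)
  qed
  have "expectation (indicator {x \<in> space M. \<forall>i\<in>I. X i x \<in> B i}) =
      expectation (\<lambda>x. (\<Prod>i\<in>I. indicator (B i) (X i x)) * (\<Prod>i\<in>I - I. extend_by_0 (\<lambda>n. 0 ^ n) (X i x)))"
    using I by (intro Bochner_Integration.integral_cong refl) (auto simp: indicator_def prod_zero_iff)
  also have "\<dots> = (\<Prod>i\<in>I. poisson_prob (m i) (B i)) * (\<Prod>i\<in>I - I. exp ((0 - 1) * m i))"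
    by (rule mixed[OF I, of "\<lambda>_. 0"]) auto
  finally show ?thesis
    using I by simp
qed

section \<open>Finite Poisson configurations\<close>

text \<open>
  In an infinite product of probability spaces, distinct coordinates are independent; a finite set of
  them reduces to a finite product.\<close>

lemma PiM_expectation_prod:
  fixes g :: "'i \<Rightarrow> 'a \<Rightarrow> real"
  assumes N: "\<And>i. prob_space (N i)" and J: "finite J" and g: "\<And>i. i \<in> J \<Longrightarrow> integrable (N i) (g i)"
  shows "(\<integral>\<omega>. (\<Prod>i\<in>J. g i (\<omega> i)) \<partial>PiM UNIV N) = (\<Prod>i\<in>J. integral\<^sup>L (N i) (g i))"
proof -
  interpret product_prob_space N UNIV
    using N by (simp add: product_prob_spaceI)
  have meas: "(\<lambda>\<omega>. \<Prod>i\<in>J. g i (\<omega> i)) \<in> borel_measurable (PiM J N)"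
    using g by (intro borel_measurable_prod measurable_compose[OF measurable_component_singleton]) auto
  have "(\<Prod>i\<in>J. integral\<^sup>L (N i) (g i)) = (\<integral>\<omega>. (\<Prod>i\<in>J. g i (\<omega> i)) \<partial>PiM J N)"
    using J g by (rule product_integral_prod[symmetric])
  also have "PiM J N = distr (PiM UNIV N) (PiM J N) (\<lambda>x. restrict x J)"
    using J by (simp add: distr_PiM_restrict_finite)
  also have "(\<integral>\<omega>. (\<Prod>i\<in>J. g i (\<omega> i)) \<partial>\<dots>) = (\<integral>\<omega>. (\<Prod>i\<in>J. g i (restrict \<omega> J i)) \<partial>PiM UNIV N)"
    using meas by (intro integral_distr measurable_restrict_subset) auto
  finally show ?thesis
    by simp
qed

lemma expectation_poisson_power:
  fixes p :: "nat pmf"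
  assumes p: "\<And>n. pmf p n = poisson_weight r n"
  shows "measure_pmf.expectation p (\<lambda>n. s ^ n) = exp ((s - 1) * r)"
proof -
  have nonneg: "0 \<le> poisson_weight r n" for n
    using pmf_nonneg[of p n] p by simp
  have "measure_pmf.expectation p (\<lambda>n. s ^ n) = (\<integral>n. s ^ n * poisson_weight r n \<partial>count_space UNIV)"
    unfolding measure_pmf_eq_density p
    by (subst integral_density) (auto simp: nonneg mult.commute)
  also have "\<dots> = (\<Sum>n. s ^ n * poisson_weight r n)"
  proof (rule integral_count_space_nat)
    have "summable (\<lambda>n. \<bar>s\<bar> ^ n * poisson_weight r n)"
      using poisson_weight_gf by (rule sums_summable)
    then show "integrable (count_space UNIV) (\<lambda>n. s ^ n * poisson_weight r n)"
      by (simp add: integrable_count_space_nat_iff abs_mult power_abs nonneg)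
  qed
  also have "\<dots> = exp ((s - 1) * r)"
    using poisson_weight_gf by (rule sums_unique[symmetric])
  finally show ?thesis .
qed

text \<open>
  A pair \<open>(n, z)\<close> encodes the finite configuration of the first \<open>n\<close> points of the sequence \<open>z\<close>. Using an
  infinite sequence lets the number of points be random without changing the sample space.\<close>

definition hits :: "'a set \<Rightarrow> nat \<times> (nat \<Rightarrow> 'a) \<Rightarrow> nat" where
  "hits A \<omega> = card {l. l < fst \<omega> \<and> snd \<omega> l \<in> A}"

lemma measurable_hits [measurable]:
  assumes A [measurable]: "A \<in> sets q"
  shows "hits A \<in> measurable (measure_pmf p \<Otimes>\<^sub>M PiM UNIV (\<lambda>_. q)) (count_space UNIV)"
proof -
  have "hits A \<in> measurable (count_space UNIV \<Otimes>\<^sub>M PiM UNIV (\<lambda>_. q)) (count_space UNIV)"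
  proof (rule measurable_pair_measure_countable1)
    fix n :: nat
    have "(\<lambda>z. hits A (n, z)) = (\<lambda>z. \<Sum>l<n. if z l \<in> A then 1 else 0)"
      by (auto simp: hits_def fun_eq_iff sum.If_cases Int_def)
    then show "(\<lambda>z. hits A (n, z)) \<in> measurable (PiM UNIV (\<lambda>_. q)) (count_space UNIV)"
      by simp
  qed auto
  moreover have "sets (measure_pmf p \<Otimes>\<^sub>M PiM UNIV (\<lambda>_. q)) = sets (count_space UNIV \<Otimes>\<^sub>M PiM UNIV (\<lambda>_. q))"
    by (rule sets_pair_measure_cong) auto
  ultimately show ?thesis
    by (simp cong: measurable_cong_sets)
qed

lemma power_hits: "s ^ hits A \<omega> = (\<Prod>l<fst \<omega>. if snd \<omega> l \<in> A then s else (1::real))"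
  by (simp add: hits_def prod.If_cases Int_def)

lemma prod_if_disjoint:
  fixes s :: "'i \<Rightarrow> real"
  assumes I: "finite I" and A: "disjoint_family_on A I"
  shows "(\<Prod>i\<in>I. if z \<in> A i then s i else 1) = 1 + (\<Sum>i\<in>I. (s i - 1) * indicator (A i) z)"
proof (cases "\<exists>j\<in>I. z \<in> A j")
  case True
  then obtain j where j: "j \<in> I" "z \<in> A j" by auto
  then have *: "z \<in> A i \<longleftrightarrow> i = j" if "i \<in> I" for i
    using A that by (auto simp: disjoint_family_on_def)
  have "(\<Prod>i\<in>I. if z \<in> A i then s i else 1) = (\<Prod>i\<in>I. if i = j then s i else 1)"
    using * by (intro prod.cong) auto
  moreover have "(\<Sum>i\<in>I. (s i - 1) * indicator (A i) z) = (\<Sum>i\<in>I. if i = j then s i - 1 else 0)"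
    using * by (intro sum.cong) (auto simp: indicator_def)
  ultimately show ?thesis
    using I j by simp
next
  case False
  then have "(\<Sum>i\<in>I. (s i - 1) * indicator (A i) z) = 0" "(\<Prod>i\<in>I. if z \<in> A i then s i else 1) = 1"
    by (auto intro!: sum.neutral prod.neutral)
  then show ?thesis by simp
qed

text \<open>
  A Poisson number of independent points with law \<open>q\<close>. By disjointness of the sets, the product of the
  powers \<open>s i ^ hits (A i)\<close> is a product over the points of
  \<open>f z = 1 + (\<Sum>i\<in>I. (s i - 1) * indicator (A i) z)\<close>. Given \<open>n\<close> points its expectation is the \<open>n\<close>-th power of
  the mean of \<open>f\<close>, and averaging over \<open>n\<close> gives the exponential. That this exponential factorizes over
  \<open>I\<close> is the reason why the counts are independent.\<close>

lemma compound_poisson_gf: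
  fixes p :: "nat pmf" and s :: "'i \<Rightarrow> real"
  assumes q: "prob_space q" and p: "\<And>n. pmf p n = poisson_weight r n"
    and I: "finite I" and A [measurable]: "\<And>i. i \<in> I \<Longrightarrow> A i \<in> sets q" and dis: "disjoint_family_on A I"
    and s: "\<And>i. i \<in> I \<Longrightarrow> \<bar>s i\<bar> \<le> 1"
  shows "(\<integral>\<omega>. (\<Prod>i\<in>I. s i ^ hits (A i) \<omega>) \<partial>(measure_pmf p \<Otimes>\<^sub>M PiM UNIV (\<lambda>_. q))) =
    exp (\<Sum>i\<in>I. (s i - 1) * (r * measure q (A i)))"
proof -
  interpret q: prob_space q by fact
  interpret Z: prob_space "PiM UNIV (\<lambda>_::nat. q)"
    by (intro prob_space_PiM q)
  interpret pair_prob_space "measure_pmf p" "PiM UNIV (\<lambda>_::nat. q)" ..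
  define f where "f z = 1 + (\<Sum>i\<in>I. (s i - 1) * indicator (A i) z)" for z
  have prod_eq: "(\<Prod>i\<in>I. s i ^ hits (A i) \<omega>) = (\<Prod>l<fst \<omega>. f (snd \<omega> l))" for \<omega>
    unfolding power_hits f_def prod_if_disjoint[OF I dis, symmetric] by (rule prod.swap)
  have f_int: "integrable q f"
    unfolding f_def by (intro Bochner_Integration.integrable_add Bochner_Integration.integrable_sum
      integrable_mult_right integrable_real_indicator) (auto simp: q.emeasure_eq_measure)
  have f_exp: "q.expectation f = 1 + (\<Sum>i\<in>I. (s i - 1) * q.prob (A i))"
    unfolding f_def
    by (subst Bochner_Integration.integral_add)
      (auto simp: q.prob_space q.emeasure_eq_measure Bochner_Integration.integral_sum
        intro!: integrable_mult_right integrable_real_indicator)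
  have int: "integrable (measure_pmf p \<Otimes>\<^sub>M PiM UNIV (\<lambda>_. q)) (\<lambda>\<omega>. \<Prod>i\<in>I. s i ^ hits (A i) \<omega>)"
  proof (rule P.integrable_const_bound[where B=1])
    show "AE \<omega> in measure_pmf p \<Otimes>\<^sub>M PiM UNIV (\<lambda>_. q). norm (\<Prod>i\<in>I. s i ^ hits (A i) \<omega>) \<le> 1"
      using s by (intro AE_I2) (auto intro!: abs_prod_le_1 simp: power_abs power_le_one)
    show "(\<lambda>\<omega>. \<Prod>i\<in>I. s i ^ hits (A i) \<omega>) \<in> borel_measurable (measure_pmf p \<Otimes>\<^sub>M PiM UNIV (\<lambda>_. q))"
      by (intro borel_measurable_prod) measurable
  qed
  have "(\<integral>\<omega>. (\<Prod>i\<in>I. s i ^ hits (A i) \<omega>) \<partial>(measure_pmf p \<Otimes>\<^sub>M PiM UNIV (\<lambda>_. q))) =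
      measure_pmf.expectation p (\<lambda>n. \<integral>z. (\<Prod>l<n. f (z l)) \<partial>PiM UNIV (\<lambda>_. q))"
    using integral_fst'[OF int] by (simp add: prod_eq)
  also have "\<dots> = measure_pmf.expectation p (\<lambda>n. (q.expectation f) ^ n)"
    using q f_int by (subst PiM_expectation_prod) auto
  also have "\<dots> = exp ((q.expectation f - 1) * r)"
    using p by (rule expectation_poisson_power)
  also have "\<dots> = exp (\<Sum>i\<in>I. (s i - 1) * (r * measure q (A i)))"
    by (simp add: f_exp sum_distrib_left ac_simps)
  finally show ?thesis .
qed

text \<open>
  Number and position laws for the points in a cell \<open>D\<close>. A null cell gets no points, and then any
  position law will do.\<close>

lemma ex_normalized_restriction:
  assumes ne: "space m \<noteq> {}" and D: "D \<in> sets m" "emeasure m D < \<infinity>"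
  obtains p :: "nat pmf" and q where "prob_space q" "sets q = sets m"
    "\<And>n. pmf p n = poisson_weight (measure m D) n"
    "\<And>A. A \<in> sets m \<Longrightarrow> measure m D * measure q A = measure m (A \<inter> D)"
proof (cases "emeasure m D = 0")
  case True
  then have 0: "measure m D = 0"
    by (simp add: measure_def)
  obtain x where x: "x \<in> space m"
    using ne by auto
  have zero: "measure m (A \<inter> D) = 0" for A
  proof -
    have "emeasure m (A \<inter> D) \<le> emeasure m D"
      using D by (intro emeasure_mono) auto
    then show ?thesis
      using True by (simp add: measure_def)
  qed
  show ?thesis
  proof (rule that[of "return m x" "return_pmf 0"])
    show "prob_space (return m x)"
      using x by (rule prob_space_return)
    show "pmf (return_pmf 0) n = poisson_weight (measure m D) n" for n
      by (auto simp: 0 poisson_weight_def indicator_def power_0_left)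
  qed (auto simp: zero 0)
next
  case False
  then have pos: "0 < measure m D"
    using D by (simp add: measure_def enn2real_positive_iff less_top[symmetric] zero_less_iff_neq_zero)
  show ?thesis
  proof (rule that[of "uniform_measure m D" "poisson_pmf (measure m D)"])
    show "prob_space (uniform_measure m D)"
      using False D by (intro prob_space_uniform_measure) auto
    show "pmf (poisson_pmf (measure m D)) n = poisson_weight (measure m D) n" for n
      using pos by (simp add: poisson_weight_def)
    show "measure m D * measure (uniform_measure m D) A = measure m (A \<inter> D)" if "A \<in> sets m" for A
      using that D pos False by (subst measure_uniform_measure) (auto simp: Int_commute)
  qed auto
qed

section \<open>Existence of the Poisson measure\<close>

text \<open>
  Bounded partial sums are eventually constant. Unbounded ones tend to \<open>\<infinity>\<close>, where the powers have limit
  \<open>0\<close>, the value of the extension.\<close>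

lemma tendsto_power_partial_sums:
  fixes h :: "nat \<Rightarrow> nat" and s :: real
  assumes s: "\<bar>s\<bar> < 1"
  shows "(\<lambda>N. s ^ (\<Sum>j<N. h j)) \<longlonglongrightarrow> extend_by_0 (\<lambda>n. s ^ n) (\<Sum>j. of_nat (h j))"
proof -
  define S where "S N = (\<Sum>j<N. h j)" for N
  have lim: "(\<lambda>N. of_nat (S N) :: ennreal) \<longlonglongrightarrow> (\<Sum>j. of_nat (h j))"
    using summable_LIMSEQ[of "\<lambda>j. of_nat (h j) :: ennreal"] by (simp add: S_def)
  have mono: "S i \<le> S j" if "i \<le> j" for i j
    using that unfolding S_def by (intro sum_mono2) auto
  have "(\<lambda>N. s ^ S N) \<longlonglongrightarrow> extend_by_0 (\<lambda>n. s ^ n) (\<Sum>j. of_nat (h j))"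
  proof (cases "\<exists>b. \<forall>N. S N \<le> b")
    case True
    then obtain b where "\<forall>N. S N \<le> b" ..
    then have fin: "finite (range S)"
      unfolding finite_nat_set_iff_bounded_le by blast
    then have "Max (range S) \<in> range S"
      by (intro Max_in) auto
    then obtain N0 where N0: "Max (range S) = S N0" by auto
    have const: "S N = S N0" if "N \<ge> N0" for N
      using Max_ge[OF fin, of "S N"] mono[OF that] N0 by simp
    have ev: "eventually (\<lambda>N. S N = S N0) sequentially"
      by (rule eventually_mono[OF eventually_ge_at_top const])
    then have "eventually (\<lambda>N. of_nat (S N) = (of_nat (S N0) :: ennreal)) sequentially"
      by (rule eventually_mono) simp
    then have "(\<lambda>N. of_nat (S N) :: ennreal) \<longlonglongrightarrow> of_nat (S N0)"
      by (rule tendsto_eventually)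
    then have "(\<Sum>j. of_nat (h j)) = (of_nat (S N0) :: ennreal)"
      using lim LIMSEQ_unique by blast
    moreover have "(\<lambda>N. s ^ S N) \<longlonglongrightarrow> s ^ S N0"
      by (rule tendsto_eventually, rule eventually_mono[OF ev]) simp
    ultimately show ?thesis by simp
  next
    case False
    have top: "filterlim S at_top sequentially"
      unfolding filterlim_at_top
    proof
      fix b
      obtain N where "\<not> S N \<le> b"
        using False by blast
      then have "\<forall>n\<ge>N. b \<le> S n"
        using mono by (meson le_trans linear)
      then show "eventually (\<lambda>n. b \<le> S n) sequentially"
        unfolding eventually_sequentially by blast
    qed
    have "(\<Sum>j. of_nat (h j)) = (\<top> :: ennreal)"
    proof (rule ccontr)
      assume "(\<Sum>j. of_nat (h j)) \<noteq> (\<top> :: ennreal)"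
      then obtain b where b: "(\<Sum>j. of_nat (h j)) \<le> (of_nat b :: ennreal)"
        by (metis ennreal_Ex_less_of_nat less_imp_le less_top)
      have "S N \<le> b" for N
      proof -
        have "(of_nat (S N) :: ennreal) \<le> (\<Sum>j. of_nat (h j))"
          using sum_le_suminf[of "\<lambda>j. of_nat (h j) :: ennreal" "{..<N}"] by (simp add: S_def)
        then show ?thesis
          using b by (meson le_trans of_nat_le_iff order_trans)
      qed
      then show False using False by blast
    qed
    moreover have "(\<lambda>N. s ^ S N) \<longlonglongrightarrow> 0"
      using filterlim_compose[OF LIMSEQ_power_zero top, of s] s by simp
    ultimately show ?thesis by simp
  qed
  then show ?thesis
    by (simp add: S_def)
qed

text \<open>
  The sum of unit masses at all the points of all the cells, with multiplicity. As the image of a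
  counting measure on the labels it is a measure by construction.\<close>

definition point_measure_of :: "'a measure \<Rightarrow> (nat \<Rightarrow> nat \<times> (nat \<Rightarrow> 'a)) \<Rightarrow> 'a measure" where
  "point_measure_of m \<omega> = distr (count_space {(j, l). l < fst (\<omega> j)}) m (\<lambda>(j, l). snd (\<omega> j) l)"

lemma emeasure_point_measure_of:
  assumes \<omega>: "\<And>j l. snd (\<omega> j) l \<in> space m" and A: "A \<in> sets m"
  shows "emeasure (point_measure_of m \<omega>) A = (\<Sum>j. of_nat (hits A (\<omega> j)))"
proof -
  let ?C = "{(j, l). l < fst (\<omega> j)}"
  let ?E = "\<lambda>j. Pair j ` {l. l < fst (\<omega> j) \<and> snd (\<omega> j) l \<in> A}"
  have fin: "finite {l. l < fst (\<omega> j) \<and> snd (\<omega> j) l \<in> A}" for j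
    by simp
  have "emeasure (point_measure_of m \<omega>) A =
      emeasure (count_space ?C) ((\<lambda>(j, l). snd (\<omega> j) l) -` A \<inter> ?C)"
    unfolding point_measure_of_def using \<omega> A by (subst emeasure_distr) auto
  also have "(\<lambda>(j, l). snd (\<omega> j) l) -` A \<inter> ?C = (\<Union>j. ?E j)"
    by auto
  also have "emeasure (count_space ?C) \<dots> = (\<Sum>j. emeasure (count_space ?C) (?E j))"
    by (rule suminf_emeasure[symmetric]) (auto simp: disjoint_family_on_def)
  also have "\<dots> = (\<Sum>j. of_nat (hits A (\<omega> j)))"
    using fin by (intro suminf_cong, subst emeasure_count_space_finite)
      (auto simp: hits_def card_image inj_on_def)
  finally show ?thesis .
qed

text \<open>
  The space is cut into countably many disjoint cells of finite measure, and independent finite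
  Poisson configurations are placed in them. For finitely many cells the joint generating functions
  of the counts multiply; dominated convergence then gives \<open>\<Prod>i\<in>J. exp ((s i - 1) * measure M (A i))\<close> for
  all cells together, and inversion of generating functions finishes the proof.\<close>

theorem (in sigma_finite_measure) ex_poisson_measure:
  assumes ne: "space M \<noteq> {}"
  shows "\<exists>P. poisson_measure M P"
proof -
  obtain D :: "nat \<Rightarrow> 'a set" where D: "range D \<subseteq> sets M" "(\<Union>i. D i) = space M"
      "\<And>i. emeasure M (D i) \<noteq> \<infinity>" "disjoint_family D"
    using sigma_finite_disjoint by metis
  have "\<exists>p q. prob_space q \<and> sets q = sets M \<and> (\<forall>n. pmf p n = poisson_weight (measure M (D j)) n) \<and>
      (\<forall>A\<in>sets M. measure M (D j) * measure q A = measure M (A \<inter> D j))" for j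
  proof -
    have Dj: "D j \<in> sets M" "emeasure M (D j) < \<infinity>"
      using D by (auto simp: less_top[symmetric])
    show ?thesis
      by (rule ex_normalized_restriction[OF ne Dj]) blast
  qed
  then obtain p :: "nat \<Rightarrow> nat pmf" and q where q: "\<And>j. prob_space (q j)" and sets_q: "\<And>j. sets (q j) = sets M"
    and p: "\<And>j n. pmf (p j) n = poisson_weight (measure M (D j)) n"
    and q_meas: "\<And>j A. A \<in> sets M \<Longrightarrow> measure M (D j) * measure (q j) A = measure M (A \<inter> D j)"
    by metis
  define \<Omega>j where "\<Omega>j j = measure_pmf (p j) \<Otimes>\<^sub>M PiM UNIV (\<lambda>_::nat. q j)" for j
  define \<Omega> where "\<Omega> = PiM UNIV \<Omega>j"
  have \<Omega>j: "prob_space (\<Omega>j j)" for j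
  proof -
    interpret q: prob_space "q j" by (rule q)
    interpret Z: prob_space "PiM UNIV (\<lambda>_::nat. q j)"
      by (intro prob_space_PiM q)
    interpret pair_prob_space "measure_pmf (p j)" "PiM UNIV (\<lambda>_::nat. q j)" ..
    show ?thesis
      unfolding \<Omega>j_def by (rule P.prob_space_axioms)
  qed
  interpret \<Omega>: prob_space \<Omega>
    unfolding \<Omega>_def by (intro prob_space_PiM \<Omega>j)
  have hits_j: "hits A \<in> measurable (\<Omega>j j) (count_space UNIV)" if "A \<in> sets M" for A j
    unfolding \<Omega>j_def using that by (intro measurable_hits) (simp add: sets_q)
  have hits_meas [measurable]: "(\<lambda>\<omega>. hits A (\<omega> j)) \<in> measurable \<Omega> (count_space UNIV)" if "A \<in> sets M" for A j
    unfolding \<Omega>_def using measurable_component_singleton[of j UNIV \<Omega>j] hits_j[OF that, of j]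
    by (intro measurable_compose[where g="hits A" and f="\<lambda>\<omega>. \<omega> j" and N="\<Omega>j j"]) auto
  have em: "emeasure (point_measure_of M \<omega>) A = (\<Sum>j. of_nat (hits A (\<omega> j)))"
    if \<omega>: "\<omega> \<in> space \<Omega>" and A: "A \<in> sets M" for \<omega> A
  proof (rule emeasure_point_measure_of[OF _ A])
    fix j l
    have "\<omega> j \<in> space (\<Omega>j j)"
      using \<omega> by (auto simp: \<Omega>_def space_PiM)
    then have "snd (\<omega> j) l \<in> space (q j)"
      by (auto simp: \<Omega>j_def space_pair_measure space_PiM)
    then show "snd (\<omega> j) l \<in> space M"
      using sets_eq_imp_space_eq[OF sets_q] by simp
  qed
  have N_meas: "(\<lambda>\<omega>. emeasure (point_measure_of M \<omega>) A) \<in> borel_measurable \<Omega>" if A [measurable]: "A \<in> sets M" for A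
    by (subst measurable_cong[OF em]) (auto intro!: borel_measurable_suminf_order)
  have \<zeta> [measurable]: "point_measure_of M \<in> measurable \<Omega> (measures_algebra M)"
    using N_meas by (intro measurable_measures_algebraI) (auto simp: point_measure_of_def)
  have gf: "\<Omega>.expectation (\<lambda>\<omega>. \<Prod>i\<in>J. extend_by_0 (\<lambda>n. s i ^ n) (emeasure (point_measure_of M \<omega>) (A i))) =
      (\<Prod>i\<in>J. exp ((s i - 1) * measure M (A i)))"
    if J: "finite J" and A: "\<And>i. i \<in> J \<Longrightarrow> A i \<in> sets M" "\<And>i. i \<in> J \<Longrightarrow> emeasure M (A i) < \<infinity>"
      "disjoint_family_on A J" and s: "\<And>i. \<bar>s i\<bar> < 1"
    for J :: "nat set" and A s
  proof (rule LIMSEQ_unique)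
    let ?f = "\<lambda>N \<omega>. \<Prod>i\<in>J. s i ^ (\<Sum>j<N. hits (A i) (\<omega> j))"
    have f_meas: "?f N \<in> borel_measurable \<Omega>" for N
      using A(1) by (intro borel_measurable_prod) measurable
    show "(\<lambda>N. \<Omega>.expectation (?f N)) \<longlonglongrightarrow>
        \<Omega>.expectation (\<lambda>\<omega>. \<Prod>i\<in>J. extend_by_0 (\<lambda>n. s i ^ n) (emeasure (point_measure_of M \<omega>) (A i)))"
    proof (rule integral_dominated_convergence[where w="\<lambda>_. 1"])
      show "AE \<omega> in \<Omega>. (\<lambda>N. ?f N \<omega>) \<longlonglongrightarrow>
          (\<Prod>i\<in>J. extend_by_0 (\<lambda>n. s i ^ n) (emeasure (point_measure_of M \<omega>) (A i)))"
        using A s by (intro AE_I2 tendsto_prod) (simp add: em tendsto_power_partial_sums)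
      show "AE \<omega> in \<Omega>. norm (?f N \<omega>) \<le> 1" for N
        using s by (intro AE_I2) (auto intro!: abs_prod_le_1 simp: power_abs less_imp_le power_le_one)
      show "(\<lambda>\<omega>. \<Prod>i\<in>J. extend_by_0 (\<lambda>n. s i ^ n) (emeasure (point_measure_of M \<omega>) (A i))) \<in> borel_measurable \<Omega>"
        using A(1) by (intro borel_measurable_prod measurable_compose[OF N_meas borel_measurable_extend_by_0])
    qed (use f_meas in auto)
    have "\<Omega>.expectation (?f N) = exp (\<Sum>i\<in>J. (s i - 1) * (\<Sum>j<N. measure M (A i \<inter> D j)))" for N
    proof -
      have "?f N = (\<lambda>\<omega>. \<Prod>j<N. \<Prod>i\<in>J. s i ^ hits (A i) (\<omega> j))"
        by (simp add: power_sum prod.swap[of _ "{..<N}" J])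
      then have "\<Omega>.expectation (?f N) = \<Omega>.expectation (\<lambda>\<omega>. \<Prod>j<N. \<Prod>i\<in>J. s i ^ hits (A i) (\<omega> j))"
        by (simp only:)
      also have "\<dots> = (\<Prod>j<N. integral\<^sup>L (\<Omega>j j) (\<lambda>\<omega>. \<Prod>i\<in>J. s i ^ hits (A i) \<omega>))"
        unfolding \<Omega>_def
      proof (subst PiM_expectation_prod)
        fix j
        interpret j: prob_space "\<Omega>j j" by (rule \<Omega>j)
        show "integrable (\<Omega>j j) (\<lambda>\<omega>. \<Prod>i\<in>J. s i ^ hits (A i) \<omega>)"
        proof (rule j.integrable_const_bound[where B=1])
          show "AE \<omega> in \<Omega>j j. norm (\<Prod>i\<in>J. s i ^ hits (A i) \<omega>) \<le> 1"
            using s by (intro AE_I2) (auto intro!: abs_prod_le_1 simp: power_abs less_imp_le power_le_one)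
          show "(\<lambda>\<omega>. \<Prod>i\<in>J. s i ^ hits (A i) \<omega>) \<in> borel_measurable (\<Omega>j j)"
            by (intro borel_measurable_prod measurable_compose[OF hits_j[OF A(1)]]) auto
        qed
      qed (use \<Omega>j in auto)
      also have "\<dots> = (\<Prod>j<N. exp (\<Sum>i\<in>J. (s i - 1) * measure M (A i \<inter> D j)))"
      proof (rule prod.cong[OF refl])
        fix j
        have "integral\<^sup>L (\<Omega>j j) (\<lambda>\<omega>. \<Prod>i\<in>J. s i ^ hits (A i) \<omega>) =
            exp (\<Sum>i\<in>J. (s i - 1) * (measure M (D j) * measure (q j) (A i)))"
          unfolding \<Omega>j_def using s A by (intro compound_poisson_gf[OF q p J]) (auto simp: sets_q less_imp_le)
        also have "\<dots> = exp (\<Sum>i\<in>J. (s i - 1) * measure M (A i \<inter> D j))"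
          using A(1) by (simp add: q_meas)
        finally show "integral\<^sup>L (\<Omega>j j) (\<lambda>\<omega>. \<Prod>i\<in>J. s i ^ hits (A i) \<omega>) = \<dots>" .
      qed
      also have "\<dots> = exp (\<Sum>j<N. \<Sum>i\<in>J. (s i - 1) * measure M (A i \<inter> D j))"
        by (simp add: exp_sum)
      also have "(\<Sum>j<N. \<Sum>i\<in>J. (s i - 1) * measure M (A i \<inter> D j)) =
          (\<Sum>i\<in>J. (s i - 1) * (\<Sum>j<N. measure M (A i \<inter> D j)))"
        by (subst sum.swap) (simp add: sum_distrib_left)
      finally show ?thesis .
    qed
    moreover have "(\<lambda>N. exp (\<Sum>i\<in>J. (s i - 1) * (\<Sum>j<N. measure M (A i \<inter> D j)))) \<longlonglongrightarrow>
        exp (\<Sum>i\<in>J. (s i - 1) * measure M (A i))"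
    proof (intro tendsto_intros)
      fix i assume i: "i \<in> J"
      have "(\<lambda>j. measure M (A i \<inter> D j)) sums measure M (\<Union>j. A i \<inter> D j)"
      proof (rule measure_UNION)
        show "range (\<lambda>j. A i \<inter> D j) \<subseteq> sets M"
          using A(1)[OF i] D(1) by auto
        show "disjoint_family (\<lambda>j. A i \<inter> D j)"
          using D(4) by (auto simp: disjoint_family_on_def)
        have "emeasure M (\<Union>j. A i \<inter> D j) \<le> emeasure M (A i)"
          using A(1)[OF i] by (intro emeasure_mono) auto
        then show "emeasure M (\<Union>j. A i \<inter> D j) \<noteq> \<infinity>"
          using A(2)[OF i] by (auto simp: top_unique)
      qed
      moreover have "(\<Union>j. A i \<inter> D j) = A i"
        using D(2) sets.sets_into_space[OF A(1)[OF i]] by auto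
      ultimately show "(\<lambda>N. \<Sum>j<N. measure M (A i \<inter> D j)) \<longlonglongrightarrow> measure M (A i)"
        by (simp add: sums_def)
    qed
    ultimately show "(\<lambda>N. \<Omega>.expectation (?f N)) \<longlonglongrightarrow> (\<Prod>i\<in>J. exp ((s i - 1) * measure M (A i)))"
      using J by (simp add: exp_sum)
  qed
  have "poisson_measure M (distr \<Omega> (measures_algebra M) (point_measure_of M))"
  proof (rule poisson_measureI)
    show "prob_space (distr \<Omega> (measures_algebra M) (point_measure_of M))"
      by (rule \<Omega>.prob_space_distr) measurable
    fix k :: nat and A and B :: "nat \<Rightarrow> ennreal set"
    assume A: "\<And>i. i < k \<Longrightarrow> A i \<in> sets M" "\<And>i. i < k \<Longrightarrow> emeasure M (A i) < \<infinity>"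
        "disjoint_family_on A {..<k}"
      and B [measurable]: "\<And>i. i < k \<Longrightarrow> B i \<in> sets borel"
    let ?S = "{\<xi> \<in> space (measures_algebra M). \<forall>i<k. emeasure \<xi> (A i) \<in> B i}"
    have [measurable]: "(\<lambda>\<xi>. emeasure \<xi> (A i)) \<in> borel_measurable (measures_algebra M)" if "i < k" for i
      using that A by (intro measurable_emeasure_measures_algebra)
    have "{\<xi> \<in> space (measures_algebra M). \<forall>i\<in>{..<k}. emeasure \<xi> (A i) \<in> B i} \<in> sets (measures_algebra M)"
      by measurable
    then have "?S \<in> sets (measures_algebra M)"
      by (simp only: Ball_def lessThan_iff)
    then have "measure (distr \<Omega> (measures_algebra M) (point_measure_of M))
        {\<xi> \<in> space (distr \<Omega> (measures_algebra M) (point_measure_of M)). \<forall>i<k. emeasure \<xi> (A i) \<in> B i} =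
        \<Omega>.prob (point_measure_of M -` ?S \<inter> space \<Omega>)"
      by (subst measure_distr) auto
    also have "point_measure_of M -` ?S \<inter> space \<Omega> =
        {\<omega> \<in> space \<Omega>. \<forall>i\<in>{..<k}. emeasure (point_measure_of M \<omega>) (A i) \<in> B i}"
      by (auto simp: point_measure_of_def)
    also have "\<Omega>.prob \<dots> = (\<Prod>i<k. poisson_prob (measure M (A i)) (B i))"
    proof (rule \<Omega>.poisson_joint_law_from_gf)
      fix J and s :: "nat \<Rightarrow> real" assume J: "J \<subseteq> {..<k}" and s: "\<And>i. \<bar>s i\<bar> < 1"
      have "finite J"
        using J finite_subset by blast
      moreover have "disjoint_family_on A J"
        using A(3) J by (auto simp: disjoint_family_on_def)
      ultimately show "\<Omega>.expectation (\<lambda>\<omega>. \<Prod>i\<in>J. extend_by_0 (\<lambda>n. s i ^ n) (emeasure (point_measure_of M \<omega>) (A i))) =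
          (\<Prod>i\<in>J. exp ((s i - 1) * measure M (A i)))"
        using A J s by (intro gf) auto
    qed (use A B N_meas in auto)
    finally show "measure (distr \<Omega> (measures_algebra M) (point_measure_of M))
        {\<xi> \<in> space (distr \<Omega> (measures_algebra M) (point_measure_of M)). \<forall>i<k. emeasure \<xi> (A i) \<in> B i} =
        (\<Prod>i<k. poisson_prob (measure M (A i)) (B i))" .
  qed simp
  then show ?thesis ..
qed

section \<open>Void probabilities\<close>

lemma poisson_void_probability:
  assumes P: "poisson_measure M P" and A: "A \<in> sets M" "emeasure M A < \<infinity>"
  shows "measure P {\<xi> \<in> space P. emeasure \<xi> A = 0} = exp (- measure M A)"
proof -
  have "measure P {\<xi> \<in> space P. \<forall>i<Suc 0. emeasure \<xi> A \<in> {0}} =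
      (\<Prod>i<Suc 0. poisson_prob (measure M A) {0})"
    using A by (intro poisson_measureD[OF P]) (auto simp: disjoint_family_on_def)
  then show ?thesis
    using poisson_prob_single[of "measure M A" 0] by (simp add: poisson_weight_def)
qed

text \<open>
  Both sets are void exactly if their union is, so independence of the two void events says
  \<open>exp (- measure M (A \<union> B)) = exp (- measure M A) * exp (- measure M B)\<close>, that is, \<open>measure M\<close> is additive
  on \<open>A\<close> and \<open>B\<close>.\<close>

lemma poisson_void_events_independent_imp_null_Int:
  assumes P: "poisson_measure M P"
    and A: "A \<in> sets M" "emeasure M A < \<infinity>" and B: "B \<in> sets M" "emeasure M B < \<infinity>"
    and indep: "measure P {\<xi> \<in> space P. emeasure \<xi> A = 0 \<and> emeasure \<xi> B = 0} =
      measure P {\<xi> \<in> space P. emeasure \<xi> A = 0} * measure P {\<xi> \<in> space P. emeasure \<xi> B = 0}"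
  shows "emeasure M (A \<inter> B) = 0"
proof -
  have space: "space P = {\<xi>. sets \<xi> = sets M}"
    using P sets_eq_imp_space_eq[of P "measures_algebra M"] by (simp add: poisson_measure_def)
  have split: "emeasure M A + emeasure M B = emeasure M (A \<union> B) + emeasure M (A \<inter> B)"
    using A B by (intro emeasure_Un_Int)
  have finite: "emeasure M (A \<union> B) < \<infinity>" "emeasure M (A \<inter> B) < \<infinity>"
  proof -
    have "emeasure M A + emeasure M B < \<infinity>"
      using A B by simp
    then show "emeasure M (A \<union> B) < \<infinity>" "emeasure M (A \<inter> B) < \<infinity>"
      unfolding split by simp_all
  qed
  have void_Un: "emeasure \<xi> (A \<union> B) = 0 \<longleftrightarrow> emeasure \<xi> A = 0 \<and> emeasure \<xi> B = 0"
    if "\<xi> \<in> space P" for \<xi>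
  proof -
    have "A \<in> sets \<xi>" "B \<in> sets \<xi>"
      using that A B by (auto simp: space)
    then show ?thesis
      using emeasure_Un_null_set[of A \<xi> B] emeasure_mono[of A "A \<union> B" \<xi>] emeasure_mono[of B "A \<union> B" \<xi>]
      by (auto simp: null_sets_def)
  qed
  have "exp (- measure M (A \<union> B)) = exp (- measure M A) * exp (- measure M B)"
    using poisson_void_probability[OF P, of A] poisson_void_probability[OF P, of B]
      poisson_void_probability[OF P, of "A \<union> B"] indep A B finite void_Un
    by (simp cong: conj_cong)
  then have "measure M (A \<union> B) = measure M A + measure M B"
    by (simp add: mult_exp_exp)
  moreover have "measure M A + measure M B = measure M (A \<union> B) + measure M (A \<inter> B)"
    using split A B finite
    by (metis enn2real_plus infinity_ennreal_def measure_def)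
  ultimately have "measure M (A \<inter> B) = 0"
    by simp
  then show ?thesis
    using finite by (simp add: emeasure_eq_ennreal_measure)
qed

section \<open>Projections of windows and suspended maps\<close>

definition restricted_image :: "'a measure \<Rightarrow> 'a set \<Rightarrow> 'b measure \<Rightarrow> ('a \<Rightarrow> 'b) \<Rightarrow> 'b measure" where
  "restricted_image \<zeta> W N f = distr (restrict_space \<zeta> W) N f"

lemma sets_restricted_image [simp]: "sets (restricted_image \<zeta> W N f) = sets N"
  by (simp add: restricted_image_def)

lemma space_restricted_image [simp]: "space (restricted_image \<zeta> W N f) = space N"
  by (simp add: restricted_image_def)

lemma emeasure_restricted_image:
  assumes \<zeta>: "sets \<zeta> = sets M" and W: "W \<in> sets M" and f: "f \<in> measurable M N" and A: "A \<in> sets N"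
  shows "emeasure (restricted_image \<zeta> W N f) A = emeasure \<zeta> (f -` A \<inter> W)"
proof -
  have "f \<in> measurable \<zeta> N"
    using f \<zeta> by (simp cong: measurable_cong_sets)
  then have "f \<in> measurable (restrict_space \<zeta> W) N"
    by (rule measurable_restrict_space1)
  moreover have "W \<subseteq> space \<zeta>"
    using W \<zeta> sets.sets_into_space[of W \<zeta>] by simp
  ultimately show ?thesis
    unfolding restricted_image_def using A W \<zeta>
    by (simp add: emeasure_distr space_restrict_space emeasure_restrict_space Int_absorb2)
qed

text \<open>
  The window may cut down an infinite intensity, whose image under \<open>f\<close> alone would not be
  \<open>\<sigma>\<close>-finite, to one with image \<open>N\<close>.\<close>

lemma
  assumes P: "poisson_measure M P" and W: "W \<in> sets M" and f: "f \<in> measurable M N"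
    and intensity: "\<And>A. A \<in> sets N \<Longrightarrow> emeasure M (f -` A \<inter> W) = emeasure N A"
  shows measurable_restricted_image:
      "(\<lambda>\<zeta>. restricted_image \<zeta> W N f) \<in> measurable P (measures_algebra N)"
    and poisson_measure_restricted_image:
      "poisson_measure N (distr P (measures_algebra N) (\<lambda>\<zeta>. restricted_image \<zeta> W N f))"
proof -
  have "f -` A \<inter> W \<in> sets M" if "A \<in> sets N" for A
  proof -
    have "f -` A \<inter> W = (f -` A \<inter> space M) \<inter> W"
      using sets.sets_into_space[OF W] by auto
    then show ?thesis
      using measurable_sets[OF f that] W by auto
  qed
  note F = this intensity
  show "(\<lambda>\<zeta>. restricted_image \<zeta> W N f) \<in> measurable P (measures_algebra N)"
    by (rule poisson_measure_image_measurable[where F="\<lambda>A. f -` A \<inter> W", OF P])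
      (use F emeasure_restricted_image[OF _ W f] in auto)
  show "poisson_measure N (distr P (measures_algebra N) (\<lambda>\<zeta>. restricted_image \<zeta> W N f))"
    by (rule poisson_measure_image[where F="\<lambda>A. f -` A \<inter> W", OF P])
      (use F emeasure_restricted_image[OF _ W f] in auto)
qed

text \<open>
  If \<open>M\<close> is \<open>\<sigma>\<close>-finite, the image law is \<open>P\<close> itself by uniqueness of the Poisson measure: this is the
  invariance of the Poisson measure under the suspended map.\<close>

lemma
  assumes P: "poisson_measure M P" and T: "T \<in> measurable M M" and inv: "distr M M T = M"
  shows measurable_suspension_map: "suspension_map M T \<in> measurable P (measures_algebra M)"
    and poisson_measure_suspension_map: "poisson_measure M (distr P (measures_algebra M) (suspension_map M T))"
proof -
  have em: "emeasure (suspension_map M T \<zeta>) A = emeasure \<zeta> (T -` A \<inter> space M)"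
    if \<zeta>: "sets \<zeta> = sets M" and A: "A \<in> sets M" for \<zeta> A
  proof -
    have "T \<in> measurable \<zeta> M"
      using T \<zeta> by (simp cong: measurable_cong_sets)
    then show ?thesis
      unfolding suspension_map_def using A sets_eq_imp_space_eq[OF \<zeta>] by (simp add: emeasure_distr)
  qed
  have pres: "emeasure M (T -` A \<inter> space M) = emeasure M A" if "A \<in> sets M" for A
    using emeasure_distr[OF T that] inv by simp
  show "suspension_map M T \<in> measurable P (measures_algebra M)"
    by (rule poisson_measure_image_measurable[where F="\<lambda>A. T -` A \<inter> space M", OF P])
      (use em pres measurable_sets[OF T] in \<open>auto simp: suspension_map_def\<close>)
  show "poisson_measure M (distr P (measures_algebra M) (suspension_map M T))"
    by (rule poisson_measure_image[where F="\<lambda>A. T -` A \<inter> space M", OF P])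
      (use em pres measurable_sets[OF T] in \<open>auto simp: suspension_map_def\<close>)
qed

lemma restricted_image_suspension_map:
  assumes \<zeta>: "sets \<zeta> = sets M" and W: "W \<in> sets M" and f: "f \<in> measurable M N"
    and R: "R \<in> measurable M M" and T: "T \<in> measurable N N"
    and equivariant: "\<And>z. z \<in> space M \<Longrightarrow> f (R z) = T (f z)"
    and invariant: "\<And>z. z \<in> space M \<Longrightarrow> R z \<in> W \<longleftrightarrow> z \<in> W"
  shows "restricted_image (suspension_map M R \<zeta>) W N f = suspension_map N T (restricted_image \<zeta> W N f)"
proof (rule measure_eqI)
  show "sets (restricted_image (suspension_map M R \<zeta>) W N f) = sets (suspension_map N T (restricted_image \<zeta> W N f))"
    by (simp add: suspension_map_def)
  fix A assume "A \<in> sets (restricted_image (suspension_map M R \<zeta>) W N f)"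
  then have A: "A \<in> sets N" by simp
  have fA: "f -` A \<inter> W \<in> sets M"
  proof -
    have "f -` A \<inter> W = (f -` A \<inter> space M) \<inter> W"
      using sets.sets_into_space[OF W] by auto
    then show ?thesis
      using measurable_sets[OF f A] W by auto
  qed
  have R': "R \<in> measurable \<zeta> M"
    using R \<zeta> by (simp cong: measurable_cong_sets)
  have T': "T \<in> measurable (restricted_image \<zeta> W N f) N"
    using T by (simp cong: measurable_cong_sets)
  have "emeasure (restricted_image (suspension_map M R \<zeta>) W N f) A =
      emeasure (suspension_map M R \<zeta>) (f -` A \<inter> W)"
    by (rule emeasure_restricted_image[OF _ W f A]) (simp add: suspension_map_def)
  also have "\<dots> = emeasure \<zeta> (R -` (f -` A \<inter> W) \<inter> space M)"
    unfolding suspension_map_def using R' fA sets_eq_imp_space_eq[OF \<zeta>] by (simp add: emeasure_distr)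
  also have "R -` (f -` A \<inter> W) \<inter> space M = f -` (T -` A \<inter> space N) \<inter> W"
    using equivariant invariant sets.sets_into_space[OF W] measurable_space[OF f] by auto
  also have "emeasure \<zeta> \<dots> = emeasure (restricted_image \<zeta> W N f) (T -` A \<inter> space N)"
    using measurable_sets[OF T A] by (rule emeasure_restricted_image[OF \<zeta> W f, symmetric])
  also have "\<dots> = emeasure (suspension_map N T (restricted_image \<zeta> W N f)) A"
    unfolding suspension_map_def using T' A
    by (simp add: emeasure_distr)
  finally show "emeasure (restricted_image (suspension_map M R \<zeta>) W N f) A =
      emeasure (suspension_map N T (restricted_image \<zeta> W N f)) A" .
qed

section \<open>From joinings of the bases to joinings of the suspensions\<close>

lemma sigma_finite_scale_measure:
  assumes "sigma_finite_measure M"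
  shows "sigma_finite_measure (scale_measure (ennreal c) M)"
proof -
  interpret sigma_finite_measure M by fact
  obtain D :: "nat \<Rightarrow> 'a set" where D: "range D \<subseteq> sets M" "(\<Union>i. D i) = space M" "\<And>i. emeasure M (D i) \<noteq> \<infinity>"
    using sigma_finite by metis
  show ?thesis
  proof
    show "\<exists>A. countable A \<and> A \<subseteq> sets (scale_measure (ennreal c) M) \<and>
        \<Union> A = space (scale_measure (ennreal c) M) \<and> (\<forall>a\<in>A. emeasure (scale_measure (ennreal c) M) a \<noteq> \<infinity>)"
      using D by (intro exI[of _ "range D"]) (auto simp: space_scale_measure ennreal_mult_eq_top_iff)
  qed
qed

text \<open>
  The points of a Poisson configuration \<open>\<zeta>\<close> over \<open>m = J \<Otimes>\<^sub>M lborel\<close> are pairs \<open>(x, y)\<close> with a mark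
  \<open>t\<close>. The points with mark in \<open>[0, 1 / c1]\<close> are projected to \<open>X\<close>, those with mark in \<open>[0, 1 / c2]\<close> to \<open>Y\<close>.
  The lengths of the windows cancel the factors \<open>c1\<close> and \<open>c2\<close> of the marginals of \<open>J\<close>, so the two
  projections have the laws \<open>P\<close> and \<open>Q\<close>. Marks are not moved by the dynamics, hence the pair of
  projections intertwines the suspension of \<open>(T \<times> S) \<times> id\<close> with \<open>T\<^sub>* \<times> S\<^sub>*\<close>. The windows overlap,
  so the two projections share points and are dependent.\<close>

lemma joining_of_suspensions:
  assumes X: "dynamical_system X T" and Y: "dynamical_system Y S"
    and P: "poisson_measure X P" and Q: "poisson_measure Y Q"
    and c: "0 < c1" "0 < c2" and J: "scaled_joining c1 c2 X T Y S J"
  obtains \<Lambda> where "joining P (suspension_map X T) Q (suspension_map Y S) \<Lambda>" "\<Lambda> \<noteq> P \<Otimes>\<^sub>M Q"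
proof -
  interpret X: sigma_finite_measure X using X by (simp add: dynamical_system_def)
  interpret Y: sigma_finite_measure Y using Y by (simp add: dynamical_system_def)
  interpret P: prob_space P using P by (simp add: poisson_measure_def)
  interpret Q: prob_space Q using Q by (simp add: poisson_measure_def)
  have T [measurable]: "T \<in> measurable X X" and T_inv: "distr X X T = X"
    and S [measurable]: "S \<in> measurable Y Y" and S_inv: "distr Y Y S = Y"
    and X_inf: "emeasure X (space X) = \<infinity>"
    using X Y by (auto simp: dynamical_system_def automorphism_def)
  have sets_P [measurable_cong]: "sets P = sets (measures_algebra X)"
    and sets_Q [measurable_cong]: "sets Q = sets (measures_algebra Y)"
    using P Q by (auto simp: poisson_measure_def)
  have space_P: "space P = {\<xi>. sets \<xi> = sets X}" and space_Q: "space Q = {\<xi>. sets \<xi> = sets Y}"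
    using sets_eq_imp_space_eq[OF sets_P] sets_eq_imp_space_eq[OF sets_Q] by simp_all
  have sets_J [measurable_cong]: "sets J = sets (X \<Otimes>\<^sub>M Y)"
    and J_inv: "distr J J (map_prod T S) = J"
    and J_fst: "distr J (scale_measure (ennreal c1) X) fst = scale_measure (ennreal c1) X"
    and J_snd: "distr J (scale_measure (ennreal c2) Y) snd = scale_measure (ennreal c2) Y"
    using J sets_pair_measure_cong[of "scale_measure (ennreal c1) X" X "scale_measure (ennreal c2) Y" Y]
    by (auto simp: scaled_joining_def joining_def)
  have space_J: "space J = space X \<times> space Y"
    using sets_eq_imp_space_eq[OF sets_J] by (simp add: space_pair_measure)
  have fst_J: "fst \<in> measurable J (scale_measure (ennreal c1) X)"
    and snd_J: "snd \<in> measurable J (scale_measure (ennreal c2) Y)"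
    by measurable
  have J_left: "emeasure J (A \<times> space Y) = ennreal c1 * emeasure X A" if "A \<in> sets X" for A
  proof -
    have "fst -` A \<inter> space J = A \<times> space Y"
      using sets.sets_into_space[OF that] by (auto simp: space_J)
    then show ?thesis
      using emeasure_distr[OF fst_J, of A] that J_fst by simp
  qed
  have J_right: "emeasure J (space X \<times> B) = ennreal c2 * emeasure Y B" if "B \<in> sets Y" for B
  proof -
    have "snd -` B \<inter> space J = space X \<times> B"
      using sets.sets_into_space[OF that] by (auto simp: space_J)
    then show ?thesis
      using emeasure_distr[OF snd_J, of B] that J_snd by simp
  qed
  have J_sf: "sigma_finite_measure J"
    using sigma_finite_measure_distr[OF _ fst_J] sigma_finite_scale_measure[OF X.sigma_finite_measure_axioms]
    by (simp add: J_fst)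
  interpret J: sigma_finite_measure J by (rule J_sf)
  interpret JL: pair_sigma_finite J "lborel :: real measure" ..
  \<comment> \<open>The infinite length of the marks leaves room for windows of any length, so \<open>c1\<close> and \<open>c2\<close> need no normalization.\<close>
  define m where "m = J \<Otimes>\<^sub>M (lborel :: real measure)"
  interpret m: sigma_finite_measure m
    unfolding m_def by (rule JL.P.sigma_finite_measure_axioms)
  have space_m: "space m = (space X \<times> space Y) \<times> UNIV"
    by (simp add: m_def space_pair_measure space_J)
  have "space X \<noteq> {}" "space Y \<noteq> {}"
    using X_inf J_left[of "space X"] c by (auto simp: ennreal_mult_eq_top_iff)
  then obtain Z where Z: "poisson_measure m Z"
    using m.ex_poisson_measure by (auto simp: space_m)
  interpret Z: prob_space Z using Z by (simp add: poisson_measure_def)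
  have sets_Z [measurable_cong]: "sets Z = sets (measures_algebra m)"
    using Z by (simp add: poisson_measure_def)
  have space_Z: "space Z = {\<zeta>. sets \<zeta> = sets m}"
    using sets_eq_imp_space_eq[OF sets_Z] by simp

  define R :: "('a \<times> 'b) \<times> real \<Rightarrow> ('a \<times> 'b) \<times> real" where "R = map_prod (map_prod T S) id"
  have TS: "map_prod T S \<in> measurable J J"
  proof -
    have "map_prod T S \<in> measurable (X \<Otimes>\<^sub>M Y) (X \<Otimes>\<^sub>M Y)"
      unfolding map_prod_def by measurable
    then show ?thesis
      using sets_J by (simp cong: measurable_cong_sets)
  qed
  have R: "R \<in> measurable m m"
    unfolding R_def m_def map_prod_def[of "map_prod T S"] id_apply using TS by measurable
  have R_inv: "distr m m R = m"
  proof -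
    have "distr J J (map_prod T S) \<Otimes>\<^sub>M distr lborel lborel (\<lambda>t::real. t) =
        distr (J \<Otimes>\<^sub>M lborel) (J \<Otimes>\<^sub>M lborel) (\<lambda>(x, t). (map_prod T S x, t))"
      using TS by (intro pair_measure_distr) (auto simp: distr_id lborel.sigma_finite_measure_axioms)
    then show ?thesis
      by (simp add: J_inv distr_id m_def R_def map_prod_def[of "map_prod T S"] id_def)
  qed
  have Z_inv: "distr Z (measures_algebra m) (suspension_map m R) = Z"
    using poisson_measure_suspension_map[OF Z R R_inv] Z by (rule m.poisson_measure_unique)

  define W1 :: "(('a \<times> 'b) \<times> real) set" where "W1 = (space X \<times> space Y) \<times> {0..1 / c1}"
  define W2 :: "(('a \<times> 'b) \<times> real) set" where "W2 = (space X \<times> space Y) \<times> {0..1 / c2}"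
  define f1 :: "('a \<times> 'b) \<times> real \<Rightarrow> 'a" where "f1 = (\<lambda>z. fst (fst z))"
  define f2 :: "('a \<times> 'b) \<times> real \<Rightarrow> 'b" where "f2 = (\<lambda>z. snd (fst z))"
  have XY: "space X \<times> space Y \<in> sets J"
    using sets.top[of J] by (simp add: space_J)
  have W: "W1 \<in> sets m" "W2 \<in> sets m"
    unfolding W1_def W2_def m_def using XY by auto
  have f1: "f1 \<in> measurable m X" and f2: "f2 \<in> measurable m Y"
    unfolding f1_def f2_def m_def by measurable
  have m_Times: "emeasure m (E \<times> {0..t}) = emeasure J E * ennreal t" if "E \<in> sets J" "0 \<le> t" for E t
    unfolding m_def using that by (subst lborel.emeasure_pair_measure_Times) auto
  have pre1: "f1 -` A \<inter> W1 = (A \<times> space Y) \<times> {0..1 / c1}" if "A \<in> sets X" for A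
    using sets.sets_into_space[OF that] by (auto simp: f1_def W1_def)
  have pre2: "f2 -` B \<inter> W2 = (space X \<times> B) \<times> {0..1 / c2}" if "B \<in> sets Y" for B
    using sets.sets_into_space[OF that] by (auto simp: f2_def W2_def)
  have cancel: "ennreal c * x * ennreal (1 / c) = x" if "0 < c" for c x
    using that by (metis (no_types, lifting) ennreal_1 ennreal_mult' less_imp_le mult.assoc mult.commute
        mult.right_neutral nonzero_mult_div_cancel_left order_less_irrefl times_divide_eq_right zero_le_divide_1_iff)
  have int1: "emeasure m (f1 -` A \<inter> W1) = emeasure X A" if A: "A \<in> sets X" for A
  proof -
    have "A \<times> space Y \<in> sets J"
      using A by (simp add: sets_J)
    then show ?thesis
      using A c by (simp add: pre1 m_Times J_left cancel)
  qed
  have int2: "emeasure m (f2 -` B \<inter> W2) = emeasure Y B" if B: "B \<in> sets Y" for B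
  proof -
    have "space X \<times> B \<in> sets J"
      using B by (simp add: sets_J)
    then show ?thesis
      using B c by (simp add: pre2 m_Times J_right cancel)
  qed
  define \<Phi>1 where "\<Phi>1 \<zeta> = restricted_image \<zeta> W1 X f1" for \<zeta>
  define \<Phi>2 where "\<Phi>2 \<zeta> = restricted_image \<zeta> W2 Y f2" for \<zeta>
  have \<Phi>1_meas [measurable]: "\<Phi>1 \<in> measurable Z (measures_algebra X)"
    and \<Phi>1_P: "poisson_measure X (distr Z (measures_algebra X) \<Phi>1)"
    unfolding \<Phi>1_def using measurable_restricted_image[OF Z W(1) f1 int1]
      poisson_measure_restricted_image[OF Z W(1) f1 int1] by auto
  have \<Phi>2_meas [measurable]: "\<Phi>2 \<in> measurable Z (measures_algebra Y)"
    and \<Phi>2_Q: "poisson_measure Y (distr Z (measures_algebra Y) \<Phi>2)"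
    unfolding \<Phi>2_def using measurable_restricted_image[OF Z W(2) f2 int2]
      poisson_measure_restricted_image[OF Z W(2) f2 int2] by auto
  have law1: "distr Z P \<Phi>1 = P"
    using X.poisson_measure_unique[OF \<Phi>1_P P] distr_cong[OF refl sets_P, of Z \<Phi>1 \<Phi>1] by simp
  have law2: "distr Z Q \<Phi>2 = Q"
    using Y.poisson_measure_unique[OF \<Phi>2_Q Q] distr_cong[OF refl sets_Q, of Z \<Phi>2 \<Phi>2] by simp
  have R_space: "R z \<in> W1 \<longleftrightarrow> z \<in> W1" "R z \<in> W2 \<longleftrightarrow> z \<in> W2" if "z \<in> space m" for z
    using that measurable_space[OF T] measurable_space[OF S] by (auto simp: R_def W1_def W2_def space_m)
  have equi1: "\<Phi>1 (suspension_map m R \<zeta>) = suspension_map X T (\<Phi>1 \<zeta>)" if "\<zeta> \<in> space Z" for \<zeta>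
    unfolding \<Phi>1_def using that
    by (intro restricted_image_suspension_map[OF _ W(1) f1 R T]) (auto simp: space_Z R_space, auto simp: R_def f1_def)
  have equi2: "\<Phi>2 (suspension_map m R \<zeta>) = suspension_map Y S (\<Phi>2 \<zeta>)" if "\<zeta> \<in> space Z" for \<zeta>
    unfolding \<Phi>2_def using that
    by (intro restricted_image_suspension_map[OF _ W(2) f2 R S]) (auto simp: space_Z R_space, auto simp: R_def f2_def)

  define \<Psi> where "\<Psi> \<zeta> = (\<Phi>1 \<zeta>, \<Phi>2 \<zeta>)" for \<zeta>
  define \<Lambda> where "\<Lambda> = distr Z (P \<Otimes>\<^sub>M Q) \<Psi>"
  have \<Psi>: "\<Psi> \<in> measurable Z (P \<Otimes>\<^sub>M Q)"
    unfolding \<Psi>_def by measurable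
  have T_star: "suspension_map X T \<in> measurable P P"
    using measurable_suspension_map[OF P T T_inv] sets_P by (simp cong: measurable_cong_sets)
  have S_star: "suspension_map Y S \<in> measurable Q Q"
    using measurable_suspension_map[OF Q S S_inv] sets_Q by (simp cong: measurable_cong_sets)
  have R_star: "suspension_map m R \<in> measurable Z Z"
    using measurable_suspension_map[OF Z R R_inv] sets_Z by (simp cong: measurable_cong_sets)
  have TS_star: "map_prod (suspension_map X T) (suspension_map Y S) \<in> measurable (P \<Otimes>\<^sub>M Q) (P \<Otimes>\<^sub>M Q)"
    unfolding map_prod_def using T_star S_star by measurable
  have "joining P (suspension_map X T) Q (suspension_map Y S) \<Lambda>"
    unfolding joining_def
  proof (intro conjI)
    show "sets \<Lambda> = sets (P \<Otimes>\<^sub>M Q)"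
      by (simp add: \<Lambda>_def)
    have "distr \<Lambda> \<Lambda> (map_prod (suspension_map X T) (suspension_map Y S)) =
        distr \<Lambda> (P \<Otimes>\<^sub>M Q) (map_prod (suspension_map X T) (suspension_map Y S))"
      by (rule distr_cong) (auto simp: \<Lambda>_def)
    also have "\<dots> = distr Z (P \<Otimes>\<^sub>M Q) (map_prod (suspension_map X T) (suspension_map Y S) \<circ> \<Psi>)"
      unfolding \<Lambda>_def by (rule distr_distr[OF TS_star \<Psi>])
    also have "\<dots> = distr Z (P \<Otimes>\<^sub>M Q) (\<Psi> \<circ> suspension_map m R)"
      by (rule distr_cong) (auto simp: \<Psi>_def equi1 equi2)
    also have "\<dots> = distr (distr Z Z (suspension_map m R)) (P \<Otimes>\<^sub>M Q) \<Psi>"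
      by (rule distr_distr[OF \<Psi> R_star, symmetric])
    also have "distr Z Z (suspension_map m R) = Z"
      using Z_inv distr_cong[OF refl sets_Z, of Z "suspension_map m R" "suspension_map m R"] by simp
    finally show "distr \<Lambda> \<Lambda> (map_prod (suspension_map X T) (suspension_map Y S)) = \<Lambda>"
      by (simp add: \<Lambda>_def)
    have "distr \<Lambda> P fst = distr Z P (fst \<circ> \<Psi>)"
      unfolding \<Lambda>_def by (rule distr_distr[OF measurable_fst \<Psi>])
    then show "distr \<Lambda> P fst = P"
      by (simp add: \<Psi>_def comp_def law1)
    have "distr \<Lambda> Q snd = distr Z Q (snd \<circ> \<Psi>)"
      unfolding \<Lambda>_def by (rule distr_distr[OF measurable_snd \<Psi>])
    then show "distr \<Lambda> Q snd = Q"
      by (simp add: \<Psi>_def comp_def law2)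
  qed
  moreover have "\<Lambda> \<noteq> P \<Otimes>\<^sub>M Q"
  proof
    assume prod: "\<Lambda> = P \<Otimes>\<^sub>M Q"
    obtain D :: "nat \<Rightarrow> 'a set" where D: "range D \<subseteq> sets X" "(\<Union>i. D i) = space X" "\<And>i. emeasure X (D i) \<noteq> \<infinity>"
      using X.sigma_finite by metis
    obtain E :: "nat \<Rightarrow> 'b set" where E: "range E \<subseteq> sets Y" "(\<Union>i. E i) = space Y" "\<And>i. emeasure Y (E i) \<noteq> \<infinity>"
      using Y.sigma_finite by metis
    \<comment> \<open>Some rectangle with sides of finite measure is charged, since \<open>J\<close> is not zero.\<close>
    have "\<exists>i k. emeasure J (D i \<times> E k) \<noteq> 0"
    proof (rule ccontr)
      assume "\<not> (\<exists>i k. emeasure J (D i \<times> E k) \<noteq> 0)"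
      then have "(\<Union>i. \<Union>k. D i \<times> E k) \<in> null_sets J"
        using D(1) E(1) by (intro null_sets_UN) (auto simp: sets_J null_sets_def)
      also have "(\<Union>i. \<Union>k. D i \<times> E k) = space X \<times> space Y"
        unfolding D(2)[symmetric] E(2)[symmetric] by auto
      finally show False
        using J_left[of "space X"] X_inf c by (auto simp: null_sets_def)
    qed
    then obtain i k where ik: "emeasure J (D i \<times> E k) \<noteq> 0" by auto
    define A B where "A = D i" and "B = E k"
    have A: "A \<in> sets X" "emeasure X A < \<infinity>" and B: "B \<in> sets Y" "emeasure Y B < \<infinity>"
      using D E by (auto simp: A_def B_def less_top[symmetric])
    \<comment> \<open>The voids of the projections in \<open>A\<close> and \<open>B\<close> are voids of \<open>\<zeta>\<close> in two overlapping sets.\<close>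
    let ?C1 = "f1 -` A \<inter> W1" and ?C2 = "f2 -` B \<inter> W2"
    have C: "?C1 \<in> sets m" "?C2 \<in> sets m"
      using A B XY unfolding pre1[OF A(1)] pre2[OF B(1)] m_def by (auto simp: sets_J)
    have void1: "emeasure (\<Phi>1 \<zeta>) A = emeasure \<zeta> ?C1" if "\<zeta> \<in> space Z" for \<zeta>
      unfolding \<Phi>1_def using that A by (intro emeasure_restricted_image[OF _ W(1) f1]) (auto simp: space_Z)
    have void2: "emeasure (\<Phi>2 \<zeta>) B = emeasure \<zeta> ?C2" if "\<zeta> \<in> space Z" for \<zeta>
      unfolding \<Phi>2_def using that B by (intro emeasure_restricted_image[OF _ W(2) f2]) (auto simp: space_Z)
    let ?E1 = "{\<xi> \<in> space P. emeasure \<xi> A = 0}" and ?E2 = "{\<xi> \<in> space Q. emeasure \<xi> B = 0}"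
    have [measurable]: "(\<lambda>\<xi>. emeasure \<xi> A) \<in> borel_measurable P" "(\<lambda>\<xi>. emeasure \<xi> B) \<in> borel_measurable Q"
      using measurable_emeasure_measures_algebra[OF A(1)] measurable_emeasure_measures_algebra[OF B(1)]
        sets_P sets_Q by (simp_all cong: measurable_cong_sets)
    have E12: "?E1 \<in> sets P" "?E2 \<in> sets Q"
      by measurable
    have "emeasure \<Lambda> (?E1 \<times> ?E2) = emeasure P ?E1 * emeasure Q ?E2"
      unfolding prod using E12 by (rule Q.emeasure_pair_measure_Times)
    moreover have "emeasure \<Lambda> (?E1 \<times> ?E2) = emeasure Z (\<Psi> -` (?E1 \<times> ?E2) \<inter> space Z)"
      unfolding \<Lambda>_def using \<Psi> E12 by (intro emeasure_distr) auto
    moreover have "\<Psi> -` (?E1 \<times> ?E2) \<inter> space Z =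
        {\<zeta> \<in> space Z. emeasure \<zeta> ?C1 = 0 \<and> emeasure \<zeta> ?C2 = 0}"
      by (auto simp: \<Psi>_def void1 void2 space_P space_Q) (auto simp: \<Phi>1_def \<Phi>2_def)
    ultimately have "measure Z {\<zeta> \<in> space Z. emeasure \<zeta> ?C1 = 0 \<and> emeasure \<zeta> ?C2 = 0} =
        measure P ?E1 * measure Q ?E2"
      by (simp add: Z.emeasure_eq_measure P.emeasure_eq_measure Q.emeasure_eq_measure
        flip: ennreal_mult)
    also have "\<dots> = measure Z {\<zeta> \<in> space Z. emeasure \<zeta> ?C1 = 0} * measure Z {\<zeta> \<in> space Z. emeasure \<zeta> ?C2 = 0}"
    proof -
      have "measure m ?C1 = measure X A" "measure m ?C2 = measure Y B"
        using int1[OF A(1)] int2[OF B(1)] by (simp_all add: measure_def)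
      then show ?thesis
        using A B C int1[OF A(1)] int2[OF B(1)]
        by (simp add: poisson_void_probability[OF P] poisson_void_probability[OF Q]
          poisson_void_probability[OF Z])
    qed
    finally have "emeasure m (?C1 \<inter> ?C2) = 0"
      using A B C int1[OF A(1)] int2[OF B(1)]
      by (intro poisson_void_events_independent_imp_null_Int[OF Z]) auto
    moreover have "?C1 \<inter> ?C2 = (A \<times> B) \<times> {0..min (1 / c1) (1 / c2)}"
      using sets.sets_into_space[OF A(1)] sets.sets_into_space[OF B(1)]
      unfolding pre1[OF A(1)] pre2[OF B(1)] by auto
    moreover have "A \<times> B \<in> sets J"
      using A B by (simp add: sets_J)
    ultimately have "emeasure J (A \<times> B) * ennreal (min (1 / c1) (1 / c2)) = 0"
      using c by (simp add: m_Times)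
    then show False
      using ik c by (auto simp: A_def B_def min_def split: if_splits)
  qed
  ultimately show ?thesis
    by (rule that)
qed

theorem corollary4p9:
  fixes X :: "'a measure" and T :: "'a \<Rightarrow> 'a"
    and Y :: "'b measure" and S :: "'b \<Rightarrow> 'b"
    and P :: "'a measure measure" and Q :: "'b measure measure"
  assumes "dynamical_system X T" and "dynamical_system Y S"
    and "poisson_measure X P" and "poisson_measure Y Q"
    and "disjoint_systems P (suspension_map X T) Q (suspension_map Y S)"
  shows "strongly_disjoint X T Y S"
  unfolding strongly_disjoint_def
proof
  assume "\<exists>c1 c2 J. 0 < c1 \<and> 0 < c2 \<and> scaled_joining c1 c2 X T Y S J"
  then obtain c1 c2 J where "0 < c1" "0 < c2" "scaled_joining c1 c2 X T Y S J"
    by blast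
  then obtain \<Lambda> where "joining P (suspension_map X T) Q (suspension_map Y S) \<Lambda>" "\<Lambda> \<noteq> P \<Otimes>\<^sub>M Q"
    using joining_of_suspensions assms by metis
  with assms(5) show False
    by (simp add: disjoint_systems_def)
qed

end
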